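(* For every $n\ge 3$ there exist normal matrices $A,B\in M_n(\mathbb{C})$ such that \[ d(\sigma(A),\sigma(B))>s_1(A-B)=\lVert A-B\rVert . \] Consequently, for every $n\ge 3$, if $r_n$ is an integer with $1\le r_n\le n$ such that \[ d(\sigma(A),\sigma(B))^2\le\sum_{k=1}^{r_n}s_k(A-B)^2 \] holds for all normal $A,B\in M_n(\mathbb{C})$, then $r_n\ge 2$. In particular, for $n=3$ and $n=4$, the integer $m_n:=\left\lfloor\frac{n+1}{2}\right\rfloor$ (which equals $2$) is the smallest integer $r$ with $1\le r\le n$ such that \[ d(\sigma(A),\sigma(B))^2\le\sum_{k=1}^{r}s_k(A-B)^2 \] holds for all normal $A,B\in M_n(\mathbb{C})$.
   Context: For normal $A,B\in M_n(\mathbb{C})$ write $\sigma(A)=\{\alpha_1,\ldots,\alpha_n\}$ and $\sigma(B)=\{\beta_1,\ldots,\beta_n\}$ for the spectra, with eigenvalues counted with algebraic multiplicity. The optimal matching distance is \[ d(\sigma(A),\sigma(B))=\min_{\tau\in S_n}\max_{1\le i\le n}|\alpha_i-\beta_{\tau(i)}| , \] where $S_n$ is the group of permutations of $\{1,\ldots,n\}$. For $M\in M_n(\mathbb{C})$, $s_1(M)\ge s_2(M)\ge\cdots\ge s_n(M)\ge 0$ are the singular values of $M$, and $\lVert M\rVert=s_1(M)$ is the spectral (operator) norm. *)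

theory Defs
  imports
    "Jordan_Normal_Form.Schur_Decomposition"
    "HOL-Computational_Algebra.Fundamental_Theorem_Algebra"
    "HOL-Combinatorics.List_Permutation"
begin

definition normal_mat :: "complex mat \<Rightarrow> bool" where
  "normal_mat A \<longleftrightarrow> A * mat_adjoint A = mat_adjoint A * A"

text \<open>
  An enumeration \<open>\<alpha>\<^sub>1, \<dots>, \<alpha>\<^sub>n\<close> of the spectrum: the roots of the characteristic polynomial, each
  listed as often as its algebraic multiplicity, in an unspecified order. The order does not
  influence the optimal matching distance, see \<open>spec_dist_eqI\<close> below.
\<close>

definition eigvals :: "complex mat \<Rightarrow> complex list" where
  "eigvals A = (SOME as. mset as = proots (char_poly A))"

lemma mset_eigvals: "mset (eigvals A) = proots (char_poly A)"
  unfolding eigvals_def by (rule someI_ex) (rule ex_mset)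

lemma length_eigvals:
  assumes "A \<in> carrier_mat n n"
  shows "length (eigvals A) = n"
proof -
  have "length (eigvals A) = size (proots (char_poly A))"
    by (metis mset_eigvals size_mset)
  also have "\<dots> = n"
    using degree_monic_char_poly[OF assms] by (simp add: size_proots_complex)
  finally show ?thesis .
qed

text \<open>Only meant for lists of equal positive length; indices run from 0.\<close>

definition matching_dist :: "complex list \<Rightarrow> complex list \<Rightarrow> real" where
  "matching_dist as bs =
     (MIN \<tau>\<in>{\<tau>. \<tau> permutes {..<length as}}. MAX i\<in>{..<length as}. cmod (as ! i - bs ! \<tau> i))"

definition spec_dist :: "complex mat \<Rightarrow> complex mat \<Rightarrow> real" where
  "spec_dist A B = matching_dist (eigvals A) (eigvals B)"

lemma matching_dist_permute_right:
  assumes "\<pi> permutes {..<length bs}" "length as = length bs"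
  shows "matching_dist as (permute_list \<pi> bs) = matching_dist as bs"
proof -
  let ?P = "{\<tau>. \<tau> permutes {..<length bs}}"
  let ?F = "\<lambda>\<tau>. MAX i\<in>{..<length bs}. cmod (as ! i - bs ! \<tau> i)"
  have eq: "(MAX i\<in>{..<length bs}. cmod (as ! i - permute_list \<pi> bs ! \<tau> i)) = ?F (\<pi> \<circ> \<tau>)"
    if "\<tau> \<in> ?P" for \<tau>
  proof -
    have "\<tau> i < length bs" if "i < length bs" for i
      using \<open>\<tau> \<in> ?P\<close> that by (metis lessThan_iff mem_Collect_eq permutes_in_image)
    then show ?thesis
      using assms(1) by (intro arg_cong[where f = Max] image_cong) (auto simp: permute_list_nth)
  qed
  have "(\<lambda>\<tau>. MAX i\<in>{..<length bs}. cmod (as ! i - permute_list \<pi> bs ! \<tau> i)) ` ?P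
      = ?F ` ((\<circ>) \<pi>) ` ?P"
    unfolding image_image by (intro image_cong refl eq)
  also have "((\<circ>) \<pi>) ` ?P = ?P"
    using image_compose_permutations_left[OF assms(1)] by (auto simp: image_def)
  finally show ?thesis
    unfolding matching_dist_def assms(2) by simp
qed

lemma matching_dist_permute_left:
  assumes "\<pi> permutes {..<length as}"
  shows "matching_dist (permute_list \<pi> as) bs = matching_dist as bs"
proof -
  let ?n = "length as"
  let ?P = "{\<tau>. \<tau> permutes {..<?n}}"
  let ?F = "\<lambda>\<tau>. MAX i\<in>{..<?n}. cmod (as ! i - bs ! \<tau> i)"
  have eq: "(MAX i\<in>{..<?n}. cmod (permute_list \<pi> as ! i - bs ! \<tau> i)) = ?F (\<tau> \<circ> inv_into UNIV \<pi>)"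
    for \<tau>
  proof -
    have "(\<lambda>i. cmod (as ! i - bs ! (\<tau> \<circ> inv_into UNIV \<pi>) i)) ` {..<?n}
        = (\<lambda>i. cmod (as ! i - bs ! (\<tau> \<circ> inv_into UNIV \<pi>) i)) ` \<pi> ` {..<?n}"
      using permutes_image[OF assms] by simp
    also have "\<dots> = (\<lambda>i. cmod (permute_list \<pi> as ! i - bs ! \<tau> i)) ` {..<?n}"
      unfolding image_image using assms
      by (intro image_cong) (auto simp: permute_list_nth permutes_inverses)
    finally show ?thesis by simp
  qed
  have "(\<lambda>\<tau>. MAX i\<in>{..<?n}. cmod (permute_list \<pi> as ! i - bs ! \<tau> i)) ` ?P
      = ?F ` (\<lambda>\<tau>. \<tau> \<circ> inv_into UNIV \<pi>) ` ?P"
    unfolding image_image by (intro image_cong refl eq)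
  also have "(\<lambda>\<tau>. \<tau> \<circ> inv_into UNIV \<pi>) ` ?P = ?P"
    using image_compose_permutations_right[OF permutes_inv[OF assms]] by (auto simp: image_def)
  finally show ?thesis
    unfolding matching_dist_def by simp
qed

lemma spec_dist_eqI:
  assumes "A \<in> carrier_mat n n" "B \<in> carrier_mat n n"
    and "mset as = proots (char_poly A)" "mset bs = proots (char_poly B)"
  shows "spec_dist A B = matching_dist as bs"
proof -
  obtain \<pi> where \<pi>: "\<pi> permutes {..<length as}" "permute_list \<pi> as = eigvals A"
    using mset_eq_permutation[of "eigvals A" as] assms(3) mset_eigvals by metis
  obtain \<rho> where \<rho>: "\<rho> permutes {..<length bs}" "permute_list \<rho> bs = eigvals B"
    using mset_eq_permutation[of "eigvals B" bs] assms(4) mset_eigvals by metis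
  have "length as = length bs"
    using \<pi>(2) \<rho>(2) length_eigvals[OF assms(1)] length_eigvals[OF assms(2)]
    by (metis length_permute_list)
  then show ?thesis
    unfolding spec_dist_def \<pi>(2)[symmetric] \<rho>(2)[symmetric]
    using \<pi>(1) \<rho>(1) by (simp add: matching_dist_permute_left matching_dist_permute_right)
qed

text \<open>
  The square roots of the eigenvalues of \<open>M\<^sup>* M\<close> (which are real and nonnegative), in decreasing
  order and with multiplicity. The index \<open>k\<close> of \<open>sing_val\<close> runs from 1 to the size of the matrix.
\<close>

definition sing_vals :: "complex mat \<Rightarrow> real list" where
  "sing_vals M = rev (sort (map (\<lambda>z. sqrt (Re z)) (eigvals (mat_adjoint M * M))))"

definition sing_val :: "nat \<Rightarrow> complex mat \<Rightarrow> real" where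
  "sing_val k M = sing_vals M ! (k - 1)"

definition vec_norm2 :: "complex vec \<Rightarrow> real" where
  "vec_norm2 v = sqrt (\<Sum>i<dim_vec v. (cmod (v $ i))\<^sup>2)"

text \<open>As for \<open>onorm\<close>, the zero vector contributes the quotient \<open>0 / 0 = 0\<close>.\<close>

definition spectral_norm :: "complex mat \<Rightarrow> real" where
  "spectral_norm M = (SUP v\<in>carrier_vec (dim_col M). vec_norm2 (M *\<^sub>v v) / vec_norm2 v)"

definition sing_val_bound :: "nat \<Rightarrow> nat \<Rightarrow> bool" where
  "sing_val_bound n r \<longleftrightarrow>
     (\<forall>A\<in>carrier_mat n n. \<forall>B\<in>carrier_mat n n. normal_mat A \<longrightarrow> normal_mat B \<longrightarrow>
        (spec_dist A B)\<^sup>2 \<le> (\<Sum>k=1..r. (sing_val k (A - B))\<^sup>2))"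

end

theory Submission
  imports Defs
begin

text \<open>
  Upper bound. If \<open>d\<close> is the matching distance, Hall's theorem yields index sets \<open>I\<close>, \<open>J\<close> with
  \<open>|I| + |J| = n + 1\<close> such that every \<open>\<alpha>\<^sub>i\<close> with \<open>i \<in> I\<close> is at distance at least \<open>d\<close> from every
  \<open>\<beta>\<^sub>j\<close> with \<open>j \<in> J\<close>. In orthonormal eigenbases \<open>P\<close> of \<open>A\<close> and \<open>Q\<close> of \<open>B\<close>, with \<open>W = P\<^sup>* Q\<close>, the
  entries of \<open>P\<^sup>* (A - B) Q\<close> are \<open>(\<alpha>\<^sub>i - \<beta>\<^sub>j) W\<^sub>i\<^sub>j\<close>. Since \<open>|W\<^sub>i\<^sub>j|\<^sup>2\<close> is doubly stochastic, its sum
  over \<open>I \<times> J\<close> is at least \<open>|I| + |J| - n = 1\<close>, so \<open>d\<^sup>2\<close> is at most the squared Frobenius norm of the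
  \<open>I \<times> J\<close> block of \<open>P\<^sup>* (A - B) Q\<close>. That block has at most \<open>(n + 1) div 2\<close> rows or at most that many
  columns, and a Ky Fan argument bounds it by the sum of as many squared singular values. This works
  for every \<open>n \<ge> 1\<close>.

  Lower bound. A rational variant of a three-dimensional example of Krause, padded by a scalar
  block, violates the bound with one singular value.
\<close>

section \<open>Hall's marriage theorem\<close>

text \<open>Halmos-Vaughan induction on \<open>card I\<close>. If some nonempty proper subset
  \<open>J\<close> has exactly \<open>card J\<close> neighbours, match \<open>J\<close> first and
  then match \<open>I - J\<close> outside those neighbours. Otherwise every such subset has a spare
  neighbour, and an arbitrary pair \<open>(i, x)\<close> can be removed.\<close>

lemma hall_marriage:
  fixes A :: "'a \<Rightarrow> 'b set"
  assumes "finite I" "\<And>i. i \<in> I \<Longrightarrow> finite (A i)"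
    and "\<And>J. J \<subseteq> I \<Longrightarrow> card J \<le> card (\<Union>i\<in>J. A i)"
  shows "\<exists>R. inj_on R I \<and> (\<forall>i\<in>I. R i \<in> A i)"
  using assms
proof (induction "card I" arbitrary: I A rule: less_induct)
  case less
  note fin = less.prems(1) and finA = less.prems(2) and hall = less.prems(3)
  show ?case
  proof (cases "I = {}")
    case True
    then show ?thesis by simp
  next
    case False
    show ?thesis
    proof (cases "\<exists>J. J \<noteq> {} \<and> J \<subset> I \<and> card J = card (\<Union>i\<in>J. A i)")
      case True
      then obtain J where J: "J \<noteq> {}" "J \<subset> I" "card J = card (\<Union>i\<in>J. A i)" by blast
      have finJ: "finite J" using J fin by (auto intro: finite_subset)
      have "card J < card I" using J(2) fin by (rule psubset_card_mono[rotated])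
      moreover have "card K \<le> card (\<Union>i\<in>K. A i)" if "K \<subseteq> J" for K
        using that J(2) by (intro hall) auto
      ultimately obtain R1 where R1: "inj_on R1 J" "\<forall>i\<in>J. R1 i \<in> A i"
        using less.hyps[of J A] finJ finA J(2) by auto
      let ?U = "\<Union>i\<in>J. A i"
      have finU: "finite ?U" using finJ finA J by auto
      have "card (I - J) < card I"
        using J fin by (intro psubset_card_mono) auto
      \<comment> \<open>Hall's condition for \<open>K \<union> J\<close>, minus the equality for
        \<open>J\<close>.\<close>
      moreover have "card K \<le> card (\<Union>i\<in>K. A i - ?U)" if K: "K \<subseteq> I - J" for K
      proof -
        have finK: "finite K" using K fin by (auto intro: finite_subset)
        have "card K + card J = card (K \<union> J)"
          using K finK finJ by (subst card_Un_disjoint) auto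
        also have "\<dots> \<le> card (\<Union>i\<in>K \<union> J. A i)" using K J by (intro hall) auto
        also have "(\<Union>i\<in>K \<union> J. A i) = (\<Union>i\<in>K. A i - ?U) \<union> ?U" by auto
        also have "card \<dots> \<le> card (\<Union>i\<in>K. A i - ?U) + card ?U" by (rule card_Un_le)
        finally show ?thesis using J(3) by simp
      qed
      ultimately obtain R2 where R2: "inj_on R2 (I - J)" "\<forall>i\<in>I - J. R2 i \<in> A i - ?U"
        using less.hyps[of "I - J" "\<lambda>i. A i - ?U"] fin finA by auto
      let ?R = "\<lambda>i. if i \<in> J then R1 i else R2 i"
      have sep: "R1 i \<noteq> R2 j" if "i \<in> J" "j \<in> I - J" for i j
      proof -
        have "R1 i \<in> ?U" using R1(2) that(1) by blast
        moreover have "R2 j \<notin> ?U" using R2(2) that(2) by blast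
        ultimately show ?thesis by metis
      qed
      have "inj_on ?R I"
      proof (rule inj_onI)
        fix i j assume "i \<in> I" "j \<in> I" "?R i = ?R j"
        then show "i = j"
          using sep[of i j] sep[of j i] inj_onD[OF R1(1), of i j] inj_onD[OF R2(1), of i j]
          by (cases "i \<in> J"; cases "j \<in> J") auto
      qed
      moreover have "?R i \<in> A i" if "i \<in> I" for i
      proof (cases "i \<in> J")
        case True
        then show ?thesis using R1(2) by simp
      next
        case False
        then have "R2 i \<in> A i - ?U" using R2(2) that by blast
        then show ?thesis using False by simp
      qed
      ultimately show ?thesis by blast
    next
      case noncrit: False
      obtain i where i: "i \<in> I" using False by blast
      have "card {i} \<le> card (\<Union>j\<in>{i}. A j)" using i by (intro hall) auto
      then obtain x where x: "x \<in> A i" by (cases "A i = {}") auto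
      have "card (I - {i}) < card I" using i fin by (metis card_Diff1_less)
      \<comment> \<open>A nonempty \<open>K\<close> is not critical here, so its inequality is
        strict, and deleting \<open>x\<close> costs at most one neighbour.\<close>
      moreover have "card K \<le> card (\<Union>j\<in>K. A j - {x})" if K: "K \<subseteq> I - {i}" for K
      proof (cases "K = {}")
        case False
        then have "card K \<noteq> card (\<Union>j\<in>K. A j)" using noncrit K i by blast
        moreover have "card K \<le> card (\<Union>j\<in>K. A j)" using K by (intro hall) auto
        moreover have "(\<Union>j\<in>K. A j - {x}) = (\<Union>j\<in>K. A j) - {x}" by auto
        ultimately show ?thesis by (cases "x \<in> (\<Union>j\<in>K. A j)") (simp_all add: card_Diff_singleton)
      qed auto
      ultimately obtain R where R: "inj_on R (I - {i})" "\<forall>j\<in>I - {i}. R j \<in> A j - {x}"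
        using less.hyps[of "I - {i}" "\<lambda>j. A j - {x}"] fin finA by auto
      have R2: "R j \<in> A j" "R j \<noteq> x" if "j \<in> I" "j \<noteq> i" for j
        using R(2) that by blast+
      have "inj_on (R(i := x)) I"
      proof (rule inj_onI)
        fix j k assume "j \<in> I" "k \<in> I" "(R(i := x)) j = (R(i := x)) k"
        then show "j = k"
          using R2(2)[of j] R2(2)[of k] inj_onD[OF R(1), of j k]
          by (cases "j = i"; cases "k = i") auto
      qed
      moreover have "(R(i := x)) j \<in> A j" if "j \<in> I" for j
        using R2(1)[OF that] x by (cases "j = i") auto
      ultimately show ?thesis by blast
    qed
  qed
qed

section \<open>Adjoints and unitary matrices\<close>

lemma mat_adjoint_index [simp]:
  "i < dim_col A \<Longrightarrow> j < dim_row A \<Longrightarrow> mat_adjoint A $$ (i, j) = conjugate (A $$ (j, i))"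
  unfolding mat_adjoint_def by (simp add: mat_of_rows_def)

lemma mat_adjoint_dim [simp]:
  "dim_row (mat_adjoint A) = dim_col A" "dim_col (mat_adjoint A) = dim_row A"
  unfolding mat_adjoint_def by auto

lemma mat_adjoint_carrier [simp]: "A \<in> carrier_mat n m \<Longrightarrow> mat_adjoint A \<in> carrier_mat m n"
  by (intro carrier_matI) auto

lemma mat_adjoint_mat_adjoint [simp]: "mat_adjoint (mat_adjoint A) = A"
  by (intro eq_matI) auto

lemma mat_adjoint_mult:
  fixes A B :: "complex mat"
  assumes "dim_col A = dim_row B"
  shows "mat_adjoint (A * B) = mat_adjoint B * mat_adjoint A"
  using assms
  by (intro eq_matI) (auto simp: scalar_prod_def mult.commute intro!: sum.cong)

text \<open>Dimension equations instead of carrier premises make this usable as a rewrite rule: no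
  intermediate dimension has to be guessed.\<close>

lemma mult_mat_assoc:
  fixes A B C :: "'a::semiring_0 mat"
  assumes "dim_col A = dim_row B" "dim_col B = dim_row C"
  shows "A * B * C = A * (B * C)"
  using assms by (intro assoc_mult_mat[of A "dim_row A" "dim_row B" B "dim_row C" C "dim_col C"] carrier_matI) simp_all

lemma mat_adjoint_one [simp]: "mat_adjoint (1\<^sub>m n :: complex mat) = 1\<^sub>m n"
  by (intro eq_matI) auto

lemma mat_adjoint_mat_diag [simp]:
  "mat_adjoint (mat_diag n f :: complex mat) = mat_diag n (\<lambda>i. cnj (f i))"
  by (intro eq_matI) (auto simp: mat_diag_def)

lemma index_mult_mat_sum:
  assumes "A \<in> carrier_mat n k" "B \<in> carrier_mat k m" "i < n" "j < m"
  shows "(A * B) $$ (i, j) = (\<Sum>l<k. A $$ (i, l) * B $$ (l, j))"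
  using assms by (auto simp: scalar_prod_def lessThan_atLeast0 intro!: sum.cong)

lemma cnj_mult_self: "cnj z * z = of_real ((cmod z)\<^sup>2)"
  by (metis complex_norm_square mult.commute)

lemma adjoint_mult_self_index:
  fixes A :: "complex mat"
  assumes "A \<in> carrier_mat n m" "j < m"
  shows "(mat_adjoint A * A) $$ (j, j) = of_real (\<Sum>i<n. (cmod (A $$ (i, j)))\<^sup>2)"
  using assms
  by (subst index_mult_mat_sum[of _ m n _ m]) (auto simp: cnj_mult_self simp del: of_real_power)

lemma mult_adjoint_self_index:
  fixes A :: "complex mat"
  assumes "A \<in> carrier_mat n m" "i < n"
  shows "(A * mat_adjoint A) $$ (i, i) = of_real (\<Sum>j<m. (cmod (A $$ (i, j)))\<^sup>2)"
  using adjoint_mult_self_index[of "mat_adjoint A" m n i] assms by auto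

definition unitary_mat :: "nat \<Rightarrow> complex mat \<Rightarrow> bool" where
  "unitary_mat n U \<longleftrightarrow> U \<in> carrier_mat n n \<and> mat_adjoint U * U = 1\<^sub>m n \<and> U * mat_adjoint U = 1\<^sub>m n"

text \<open>A one-sided inverse of a square matrix is two-sided.\<close>

lemma unitary_matI:
  assumes "U \<in> carrier_mat n n" "mat_adjoint U * U = 1\<^sub>m n"
  shows "unitary_mat n U"
  using assms mat_mult_left_right_inverse[of "mat_adjoint U" n U] unfolding unitary_mat_def by auto

lemma unitary_matD:
  assumes "unitary_mat n U"
  shows "U \<in> carrier_mat n n" "mat_adjoint U * U = 1\<^sub>m n" "U * mat_adjoint U = 1\<^sub>m n"
  using assms unfolding unitary_mat_def by auto

lemma unitary_mat_adjoint: "unitary_mat n U \<Longrightarrow> unitary_mat n (mat_adjoint U)"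
  unfolding unitary_mat_def by simp

text \<open>Meant for a unitary matrix and its adjoint, in either order, meeting inside a longer
  product.\<close>

lemma mult_cancel_middle:
  fixes A :: "'a::comm_ring_1 mat"
  assumes "A \<in> carrier_mat k n" "B \<in> carrier_mat n n" "C \<in> carrier_mat n n" "D \<in> carrier_mat n m"
    and "B * C = 1\<^sub>m n"
  shows "A * B * (C * D) = A * D"
proof -
  have "A * B * (C * D) = A * ((B * C) * D)"
    using assms(1-4) by (auto simp: mult_mat_assoc)
  then show ?thesis using assms by simp
qed

lemma unitary_mat_mult:
  assumes "unitary_mat n U" "unitary_mat n V"
  shows "unitary_mat n (U * V)"
proof (rule unitary_matI)
  note U = unitary_matD[OF assms(1)] and V = unitary_matD[OF assms(2)]
  show "U * V \<in> carrier_mat n n" using U V by simp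
  have "mat_adjoint (U * V) * (U * V) = mat_adjoint V * mat_adjoint U * (U * V)"
    using U(1) V(1) by (simp add: mat_adjoint_mult)
  also have "\<dots> = mat_adjoint V * V"
    using U V by (intro mult_cancel_middle[of _ n n]) auto
  finally show "mat_adjoint (U * V) * (U * V) = 1\<^sub>m n" using V by simp
qed

lemma unitary_mat_col_norm:
  assumes "unitary_mat n U" "j < n"
  shows "(\<Sum>i<n. (cmod (U $$ (i, j)))\<^sup>2) = 1"
proof -
  have "complex_of_real (\<Sum>i<n. (cmod (U $$ (i, j)))\<^sup>2) = 1"
    using adjoint_mult_self_index[of U n n j] unitary_matD[OF assms(1)] assms(2) by simp
  then show ?thesis using of_real_eq_1_iff by blast
qed

lemma unitary_mat_row_norm:
  assumes "unitary_mat n U" "i < n"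
  shows "(\<Sum>j<n. (cmod (U $$ (i, j)))\<^sup>2) = 1"
proof -
  have "(\<Sum>j<n. (cmod (U $$ (i, j)))\<^sup>2) = (\<Sum>j<n. (cmod (mat_adjoint U $$ (j, i)))\<^sup>2)"
    using assms(2) unitary_matD(1)[OF assms(1)] by (intro sum.cong) auto
  then show ?thesis
    using unitary_mat_col_norm[OF unitary_mat_adjoint[OF assms(1)] assms(2)] by simp
qed

lemma conjugation_mult:
  assumes U: "unitary_mat n U" and A: "A \<in> carrier_mat n n" and B: "B \<in> carrier_mat n n"
  shows "(mat_adjoint U * A * U) * (mat_adjoint U * B * U) = mat_adjoint U * (A * B) * U"
proof -
  note u = unitary_matD[OF U]
  have "(mat_adjoint U * A * U) * (mat_adjoint U * B * U) = (mat_adjoint U * A * U) * (mat_adjoint U * (B * U))"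
    using u(1) A B by (auto simp: mult_mat_assoc)
  also have "\<dots> = (mat_adjoint U * A) * (B * U)"
    using u A B by (intro mult_cancel_middle[of _ n n]) auto
  also have "\<dots> = mat_adjoint U * (A * B) * U"
    using u(1) A B by (auto simp: mult_mat_assoc)
  finally show ?thesis .
qed

lemma conjugation_adjoint:
  fixes U A :: "complex mat"
  assumes U: "U \<in> carrier_mat n n" and A: "A \<in> carrier_mat n n"
  shows "mat_adjoint (mat_adjoint U * A * U) = mat_adjoint U * mat_adjoint A * U"
  using U A by (auto simp: mat_adjoint_mult mult_mat_assoc)

lemma normal_mat_conjugation:
  assumes U: "unitary_mat n U" and A: "A \<in> carrier_mat n n" and N: "normal_mat A"
  shows "normal_mat (mat_adjoint U * A * U)"
proof -
  have A': "mat_adjoint A \<in> carrier_mat n n" using A by simp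
  show ?thesis
    using N unfolding normal_mat_def conjugation_adjoint[OF unitary_matD(1)[OF U] A]
      conjugation_mult[OF U A A'] conjugation_mult[OF U A' A] by simp
qed

lemma char_poly_conjugation:
  assumes U: "unitary_mat n U" and A: "A \<in> carrier_mat n n"
  shows "char_poly (mat_adjoint U * A * U) = char_poly A"
proof (rule char_poly_similar)
  note u = unitary_matD[OF U]
  have "similar_mat_wit (mat_adjoint U * A * U) A (mat_adjoint U) U"
    using u A by (intro similar_mat_witI[of _ _ n]) auto
  then show "similar_mat (mat_adjoint U * A * U) A" unfolding similar_mat_def by blast
qed

section \<open>Unitary diagonalization of normal matrices\<close>

text \<open>Each column is divided by its norm. The conclusion records the scalars \<open>c\<close>
  because the deflation below needs the first column of \<open>U\<close> to stay parallel to that of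
  \<open>W\<close>.\<close>

lemma corthogonal_mat_normalize:
  fixes W :: "complex mat"
  assumes W: "W \<in> carrier_mat n n" and orth: "corthogonal_mat W"
  shows "\<exists>U c. unitary_mat n U \<and> (\<forall>i<n. \<forall>j<n. U $$ (i, j) = W $$ (i, j) * c j)"
proof -
  define r where "r j = (\<Sum>i<n. (cmod (W $$ (i, j)))\<^sup>2)" for j
  define c where "c j = complex_of_real (1 / sqrt (r j))" for j
  define U where "U = mat n n (\<lambda>(i, j). W $$ (i, j) * c j)"
  have U: "U \<in> carrier_mat n n" unfolding U_def by simp
  have WW: "(mat_adjoint W * W) $$ (i, j) = (\<Sum>l<n. cnj (W $$ (l, i)) * W $$ (l, j))"
    if "i < n" "j < n" for i j
    using W that by (subst index_mult_mat_sum[of _ n n _ n]) (auto intro!: sum.cong)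
  have off: "(mat_adjoint W * W) $$ (i, j) = 0" if "i < n" "j < n" "i \<noteq> j" for i j
    using orth W that unfolding corthogonal_mat_def Let_def diagonal_mat_def by auto
  have diag: "(mat_adjoint W * W) $$ (j, j) = of_real (r j)" if "j < n" for j
    using adjoint_mult_self_index[OF W that] unfolding r_def by simp
  \<comment> \<open>\<open>corthogonal_mat\<close> includes that the diagonal of the Gram matrix has
    no zero, so no column vanishes.\<close>
  have r0: "r j > 0" if "j < n" for j
  proof -
    have "r j \<noteq> 0"
      using orth diag[OF that] W that unfolding corthogonal_mat_def Let_def by auto
    moreover have "r j \<ge> 0" unfolding r_def by (intro sum_nonneg) simp
    ultimately show ?thesis by simp
  qed
  have "mat_adjoint U * U = 1\<^sub>m n"
  proof (rule eq_matI)
    fix i j assume "i < dim_row (1\<^sub>m n :: complex mat)" "j < dim_col (1\<^sub>m n :: complex mat)"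
    then have ij: "i < n" "j < n" by auto
    have "(mat_adjoint U * U) $$ (i, j) = (\<Sum>l<n. mat_adjoint U $$ (i, l) * U $$ (l, j))"
      using U ij by (intro index_mult_mat_sum) auto
    also have "\<dots> = (\<Sum>l<n. (cnj (c i) * c j) * (cnj (W $$ (l, i)) * W $$ (l, j)))"
      using ij by (intro sum.cong) (auto simp: U_def)
    also have "\<dots> = (cnj (c i) * c j) * (mat_adjoint W * W) $$ (i, j)"
      unfolding WW[OF ij] sum_distrib_left ..
    also have "\<dots> = (if i = j then 1 else 0)"
    proof (cases "i = j")
      case True
      have "(cnj (c i) * c j) * (mat_adjoint W * W) $$ (i, j)
          = of_real (1 / sqrt (r j) * (1 / sqrt (r j)) * r j)"
        unfolding True diag[OF ij(2)] c_def complex_cnj_complex_of_real of_real_mult ..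
      also have "1 / sqrt (r j) * (1 / sqrt (r j)) * r j = 1"
        using r0[OF ij(2)] by simp
      finally show ?thesis using True by simp
    qed (simp add: off[OF ij])
    finally show "(mat_adjoint U * U) $$ (i, j) = 1\<^sub>m n $$ (i, j)" using ij by simp
  qed (use U in auto)
  then have "unitary_mat n U" using U by (intro unitary_matI)
  moreover have "\<forall>i<n. \<forall>j<n. U $$ (i, j) = W $$ (i, j) * c j" unfolding U_def by auto
  ultimately show ?thesis by blast
qed

text \<open>Complete an eigenvector to a basis, orthogonalize it and normalize. The first column of
  \<open>U\<close> is then an eigenvector, so \<open>A * U\<close> multiplies that column by
  \<open>e\<close>, and \<open>mat_adjoint U\<close> sends it back to \<open>e\<close> times the
  first unit vector.\<close>

lemma unitary_eigenvector_deflation: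
  fixes A :: "complex mat"
  assumes A: "A \<in> carrier_mat n n" and e: "eigenvalue A e" and n: "0 < n"
  shows "\<exists>U. unitary_mat n U \<and>
    (\<forall>i<n. (mat_adjoint U * A * U) $$ (i, 0) = (if i = 0 then e else 0))"
proof -
  define v where "v = find_eigenvector A e"
  have v: "v \<in> carrier_vec n" "v \<noteq> 0\<^sub>v n" "A *\<^sub>v v = e \<cdot>\<^sub>v v"
    using find_eigenvector[OF A e] A unfolding v_def eigenvector_def by auto
  define ws where "ws = gram_schmidt n (basis_completion v)"
  interpret cof_vec_space n "TYPE(complex)" .
  note b = basis_completion[OF v(1,2)]
  note gs = gram_schmidt_result[OF b(2,4,5) refl, folded ws_def]
  have len: "length ws = n" using gs(4) b(6) by simp
  obtain vs where bv: "basis_completion v = v # vs"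
    using b(6,7) n by (cases "basis_completion v") auto
  \<comment> \<open>Gram-Schmidt keeps the first vector of the basis.\<close>
  have hd: "ws ! 0 = v"
    using gram_schmidt_hd[OF v(1), of vs] len n unfolding ws_def bv by (metis hd_conv_nth length_0_conv less_numeral_extra(3))
  define W where "W = mat_of_cols n ws"
  have W: "W \<in> carrier_mat n n" unfolding W_def using len by auto
  have "corthogonal_mat W"
    unfolding W_def using gs(2,3) len by (intro orthogonal_mat_of_cols) auto
  then obtain U c where U: "unitary_mat n U"
    and c: "\<And>i j. i < n \<Longrightarrow> j < n \<Longrightarrow> U $$ (i, j) = W $$ (i, j) * c j"
    using corthogonal_mat_normalize[OF W] by blast
  note u = unitary_matD[OF U]
  have U0: "U $$ (i, 0) = v $ i * c 0" if "i < n" for i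
    using c[OF that n] hd len n that unfolding W_def by (simp add: mat_of_cols_index)
  have AU: "(A * U) $$ (i, 0) = e * U $$ (i, 0)" if "i < n" for i
  proof -
    have "(A * U) $$ (i, 0) = (\<Sum>l<n. A $$ (i, l) * U $$ (l, 0))"
      using A u(1) n that by (intro index_mult_mat_sum) auto
    also have "\<dots> = (\<Sum>l<n. A $$ (i, l) * v $ l) * c 0"
      unfolding sum_distrib_right by (intro sum.cong) (auto simp: U0)
    also have "(\<Sum>l<n. A $$ (i, l) * v $ l) = (A *\<^sub>v v) $ i"
      using A v(1) that by (auto simp: scalar_prod_def lessThan_atLeast0 intro!: sum.cong)
    also have "\<dots> = e * v $ i" unfolding v(3) using v(1) that by simp
    finally show ?thesis using U0[OF that] by simp
  qed
  have "(mat_adjoint U * A * U) $$ (i, 0) = (if i = 0 then e else 0)" if i: "i < n" for i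
  proof -
    have "mat_adjoint U * A * U = mat_adjoint U * (A * U)"
      using u(1) A by (auto simp: mult_mat_assoc)
    also have "(mat_adjoint U * (A * U)) $$ (i, 0) = (\<Sum>l<n. mat_adjoint U $$ (i, l) * (A * U) $$ (l, 0))"
      using A u(1) n i by (intro index_mult_mat_sum) auto
    also have "\<dots> = e * (\<Sum>l<n. mat_adjoint U $$ (i, l) * U $$ (l, 0))"
      unfolding sum_distrib_left by (intro sum.cong) (auto simp: AU)
    also have "(\<Sum>l<n. mat_adjoint U $$ (i, l) * U $$ (l, 0)) = (mat_adjoint U * U) $$ (i, 0)"
      using u(1) n i by (intro index_mult_mat_sum[symmetric]) auto
    finally show ?thesis using u(2) i n by simp
  qed
  then show ?thesis using U by blast
qed

section \<open>Block diagonal matrices and the spectral theorem\<close>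

lemma mat_adjoint_four_block_diag:
  fixes A B :: "complex mat"
  assumes "A \<in> carrier_mat n n" "B \<in> carrier_mat m m"
  shows "mat_adjoint (four_block_mat A (0\<^sub>m n m) (0\<^sub>m m n) B)
    = four_block_mat (mat_adjoint A) (0\<^sub>m n m) (0\<^sub>m m n) (mat_adjoint B)"
  using assms by (intro eq_matI) auto

lemma mult_four_block_diag:
  fixes A B C D :: "complex mat"
  assumes "A \<in> carrier_mat n n" "B \<in> carrier_mat m m" "C \<in> carrier_mat n n" "D \<in> carrier_mat m m"
  shows "four_block_mat A (0\<^sub>m n m) (0\<^sub>m m n) B * four_block_mat C (0\<^sub>m n m) (0\<^sub>m m n) D
    = four_block_mat (A * C) (0\<^sub>m n m) (0\<^sub>m m n) (B * D)"
  using assms by (subst mult_four_block_mat[of _ n n _ m _ m _ _ n _ m]) auto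

lemma four_block_diag_eqD:
  fixes A B C D :: "complex mat"
  assumes "A \<in> carrier_mat n n" "B \<in> carrier_mat m m" "C \<in> carrier_mat n n" "D \<in> carrier_mat m m"
    and eq: "four_block_mat A (0\<^sub>m n m) (0\<^sub>m m n) B = four_block_mat C (0\<^sub>m n m) (0\<^sub>m m n) D"
  shows "B = D"
proof (rule eq_matI)
  fix i j assume ij: "i < dim_row D" "j < dim_col D"
  show "B $$ (i, j) = D $$ (i, j)"
    using arg_cong[OF eq, of "\<lambda>M. M $$ (i + n, j + n)"] assms(1-4) ij by auto
qed (use assms in auto)

text \<open>The order of the eigenvalues is prescribed by \<open>es\<close>, so that singular values
  can later be listed decreasingly. Deflation clears the first column below the diagonal, normality
  then clears the first row, and the induction hypothesis handles the remaining block.\<close>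

theorem normal_mat_unitarily_diagonalizable:
  assumes "A \<in> carrier_mat n n" "normal_mat A" "mset es = proots (char_poly A)"
  shows "\<exists>U. unitary_mat n U \<and> mat_adjoint U * A * U = mat_diag n ((!) es)"
  using assms
proof (induction n arbitrary: A es)
  case 0
  have "unitary_mat 0 (1\<^sub>m 0)" by (intro unitary_matI) auto
  moreover have "mat_adjoint (1\<^sub>m 0) * A * 1\<^sub>m 0 = mat_diag 0 ((!) es)"
    using 0 by (intro eq_matI) (auto simp: mat_diag_def)
  ultimately show ?case by blast
next
  case (Suc n)
  note A = Suc.prems(1)
  have "size (mset es) = Suc n"
    unfolding Suc.prems(3) using degree_monic_char_poly[OF A] by (simp add: size_proots_complex)
  then obtain e es' where es: "es = e # es'" by (cases es) auto
  have "e \<in># proots (char_poly A)" using Suc.prems(3) es by (metis list.set_intros(1) set_mset_mset)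
  moreover have cp0: "char_poly A \<noteq> 0" using degree_monic_char_poly[OF A] by auto
  ultimately have "eigenvalue A e"
    unfolding eigenvalue_root_char_poly[OF A] using cp0 by simp
  then obtain U where U: "unitary_mat (Suc n) U"
    and col: "\<And>i. i < Suc n \<Longrightarrow> (mat_adjoint U * A * U) $$ (i, 0) = (if i = 0 then e else 0)"
    using unitary_eigenvector_deflation[OF A] by blast
  define A' where "A' = mat_adjoint U * A * U"
  note col = col[folded A'_def]
  have A': "A' \<in> carrier_mat (Suc n) (Suc n)" using unitary_matD[OF U] A unfolding A'_def by auto
  have normal: "normal_mat A'" unfolding A'_def by (rule normal_mat_conjugation[OF U A Suc.prems(2)])
  \<comment> \<open>Entry \<open>(0, 0)\<close> of the normality equation: the first row and the
    first column have equal norms, and the column has no nonzero entry besides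
    \<open>e\<close>.\<close>
  have "complex_of_real (\<Sum>j<Suc n. (cmod (A' $$ (0, j)))\<^sup>2) = of_real (\<Sum>i<Suc n. (cmod (A' $$ (i, 0)))\<^sup>2)"
    using mult_adjoint_self_index[OF A', of 0] adjoint_mult_self_index[OF A', of 0] normal
    unfolding normal_mat_def by simp
  then have "(\<Sum>j<Suc n. (cmod (A' $$ (0, j)))\<^sup>2) = (\<Sum>i<Suc n. (cmod (A' $$ (i, 0)))\<^sup>2)"
    using of_real_eq_iff by blast
  then have "(\<Sum>j<n. (cmod (A' $$ (0, Suc j)))\<^sup>2) = 0"
    unfolding sum.lessThan_Suc_shift using col by simp
  then have row: "A' $$ (0, Suc j) = 0" if "j < n" for j
    using that by (subst (asm) sum_nonneg_eq_0_iff) auto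
  define A3 where "A3 = mat n n (\<lambda>(i, j). A' $$ (Suc i, Suc j))"
  define E where "E = mat 1 1 (\<lambda>_. e)"
  have A3: "A3 \<in> carrier_mat n n" and E: "E \<in> carrier_mat 1 1" unfolding A3_def E_def by auto
  have block: "A' = four_block_mat E (0\<^sub>m 1 n) (0\<^sub>m n 1) A3"
  proof (rule eq_matI)
    fix i j assume "i < dim_row (four_block_mat E (0\<^sub>m 1 n) (0\<^sub>m n 1) A3)"
      "j < dim_col (four_block_mat E (0\<^sub>m 1 n) (0\<^sub>m n 1) A3)"
    then have "i < Suc n" "j < Suc n" using A3 E by auto
    then show "A' $$ (i, j) = four_block_mat E (0\<^sub>m 1 n) (0\<^sub>m n 1) A3 $$ (i, j)"
      using col row A3 E by (cases i; cases j) (auto simp: A3_def E_def)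
  qed (use A' A3 E in auto)
  have "normal_mat A3"
    using normal A3 E unfolding normal_mat_def block mat_adjoint_four_block_diag[OF E A3]
    by (subst (asm) mult_four_block_diag, simp_all, subst (asm) mult_four_block_diag, simp_all)
      (rule four_block_diag_eqD[of "E * mat_adjoint E" 1 _ n "mat_adjoint E * E"], auto)
  \<comment> \<open>The 1 by 1 block \<open>E\<close> accounts for one occurrence of
    \<open>e\<close>, which leaves \<open>es'\<close> to the block \<open>A3\<close>.\<close>
  moreover have "mset es' = proots (char_poly A3)"
  proof -
    have "char_poly A = char_poly A'" unfolding A'_def by (rule char_poly_conjugation[OF U A, symmetric])
    also have "\<dots> = char_poly E * char_poly A3"
      unfolding block by (rule char_poly_four_block_zeros_col[OF E _ A3]) simp
    also have "char_poly E = [:- e, 1:]"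
      by (simp add: E_def char_poly_defs det_def sign_def)
    finally have "char_poly A = [:- e, 1:] * char_poly A3" .
    moreover have "char_poly A3 \<noteq> 0" using degree_monic_char_poly[OF A3] by auto
    ultimately have "proots (char_poly A) = {#e#} + proots (char_poly A3)"
      by (simp add: proots_mult del: mult_pCons_left)
    then show ?thesis using Suc.prems(3) es by simp
  qed
  ultimately obtain V where V: "unitary_mat n V" "mat_adjoint V * A3 * V = mat_diag n ((!) es')"
    using Suc.IH[OF A3] by blast
  note v = unitary_matD[OF V(1)]
  define X where "X = four_block_mat (1\<^sub>m 1) (0\<^sub>m 1 n) (0\<^sub>m n 1) V"
  have X_adj: "mat_adjoint X = four_block_mat (1\<^sub>m 1) (0\<^sub>m 1 n) (0\<^sub>m n 1) (mat_adjoint V)"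
    unfolding X_def using v by (simp add: mat_adjoint_four_block_diag)
  have X: "unitary_mat (Suc n) X"
  proof (rule unitary_matI)
    show "X \<in> carrier_mat (Suc n) (Suc n)" unfolding X_def using v by auto
    have "mat_adjoint X * X = four_block_mat (1\<^sub>m 1) (0\<^sub>m 1 n) (0\<^sub>m n 1) (1\<^sub>m n)"
      unfolding X_adj unfolding X_def using v by (subst mult_four_block_diag) auto
    then show "mat_adjoint X * X = 1\<^sub>m (Suc n)" by simp
  qed
  have "mat_adjoint X * A' * X = four_block_mat E (0\<^sub>m 1 n) (0\<^sub>m n 1) (mat_adjoint V * A3 * V)"
    unfolding X_adj block unfolding X_def
    using v(1) E A3 by (subst mult_four_block_diag, auto)+
  also have "\<dots> = mat_diag (Suc n) ((!) es)"
    unfolding V(2) es using E by (intro eq_matI) (auto simp: mat_diag_def E_def nth_Cons')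
  finally have "mat_adjoint X * A' * X = mat_diag (Suc n) ((!) es)" .
  moreover have "mat_adjoint (U * X) * A * (U * X) = mat_adjoint X * A' * X"
    using unitary_matD(1)[OF U] unitary_matD(1)[OF X] A unfolding A'_def
    by (auto simp: mult_mat_assoc mat_adjoint_mult)
  ultimately show ?case using unitary_mat_mult[OF U X] by metis
qed

section \<open>Singular values\<close>

lemma normal_mat_gram:
  fixes M :: "complex mat"
  shows "normal_mat (mat_adjoint M * M)"
  unfolding normal_mat_def by (simp add: mat_adjoint_mult)

lemma gram_conjugation:
  fixes M U :: "complex mat"
  assumes "M \<in> carrier_mat n n" "U \<in> carrier_mat n n"
  shows "mat_adjoint (M * U) * (M * U) = mat_adjoint U * (mat_adjoint M * M) * U"
  using assms by (auto simp: mult_mat_assoc mat_adjoint_mult)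

text \<open>After diagonalizing, \<open>z\<close> is the squared norm of a column of
  \<open>M * U\<close>. Hence \<open>Re\<close> and \<open>sqrt\<close> in \<open>sing_vals\<close>
  lose no information.\<close>

lemma gram_eigenvalue_nonneg:
  assumes M: "M \<in> carrier_mat n n" and z: "z \<in> set (eigvals (mat_adjoint M * M))"
  shows "complex_of_real ((sqrt (Re z))\<^sup>2) = z"
proof -
  let ?G = "mat_adjoint M * M"
  have G: "?G \<in> carrier_mat n n" using M by auto
  obtain U where U: "unitary_mat n U" "mat_adjoint U * ?G * U = mat_diag n ((!) (eigvals ?G))"
    using normal_mat_unitarily_diagonalizable[OF G normal_mat_gram mset_eigvals] by blast
  note u = unitary_matD[OF U(1)]
  obtain i where i: "i < n" "z = eigvals ?G ! i"
    using z length_eigvals[OF G] by (metis in_set_conv_nth)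
  have "z = (mat_adjoint (M * U) * (M * U)) $$ (i, i)"
    unfolding gram_conjugation[OF M u(1)] U(2) using i by (simp add: mat_diag_def)
  also have "\<dots> = of_real (\<Sum>l<n. (cmod ((M * U) $$ (l, i)))\<^sup>2)"
    using M u i by (intro adjoint_mult_self_index) auto
  finally have z: "z = of_real (\<Sum>l<n. (cmod ((M * U) $$ (l, i)))\<^sup>2)" .
  have "Re z \<ge> 0" unfolding z Re_complex_of_real by (intro sum_nonneg) simp
  then have "(sqrt (Re z))\<^sup>2 = Re z" by simp
  then show ?thesis unfolding z by (simp only: Re_complex_of_real)
qed

text \<open>Supplies the decreasing enumeration of the spectrum of \<open>mat_adjoint M * M\<close>
  that the diagonalization theorem takes as its prescribed order.\<close>

lemma mset_sing_vals_squared: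
  assumes M: "M \<in> carrier_mat n n"
  shows "mset (map (\<lambda>s. complex_of_real (s\<^sup>2)) (sing_vals M)) = proots (char_poly (mat_adjoint M * M))"
proof -
  let ?es = "eigvals (mat_adjoint M * M)"
  have "mset (map (\<lambda>s. complex_of_real (s\<^sup>2)) (sing_vals M))
      = mset (map (\<lambda>z. complex_of_real ((sqrt (Re z))\<^sup>2)) ?es)"
    unfolding sing_vals_def by (simp add: image_mset.compositionality o_def del: of_real_power)
  also have "map (\<lambda>z. complex_of_real ((sqrt (Re z))\<^sup>2)) ?es = ?es"
    by (rule map_idI) (rule gram_eigenvalue_nonneg[OF M])
  finally show ?thesis using mset_eigvals by simp
qed

lemma length_sing_vals:
  assumes "M \<in> carrier_mat n n"
  shows "length (sing_vals M) = n"
  unfolding sing_vals_def using assms length_eigvals[of "mat_adjoint M * M" n]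
  by (simp add: mult_carrier_mat[of _ n n])

lemma sing_vals_nonneg:
  assumes "M \<in> carrier_mat n n" "i < n"
  shows "0 \<le> sing_vals M ! i"
proof -
  have "sing_vals M ! i \<in> set (sing_vals M)" using assms by (intro nth_mem) (simp add: length_sing_vals)
  then obtain z where "z \<in> set (eigvals (mat_adjoint M * M))" "sing_vals M ! i = sqrt (Re z)"
    unfolding sing_vals_def by auto
  moreover from this have "Re z = (sqrt (Re z))\<^sup>2"
    using arg_cong[OF gram_eigenvalue_nonneg[OF assms(1), of z], of Re] by (simp only: Re_complex_of_real)
  then have "0 \<le> Re z" using zero_le_power2[of "sqrt (Re z)"] by linarith
  ultimately show ?thesis by simp
qed

lemma sing_vals_antimono:
  assumes "M \<in> carrier_mat n n" "i \<le> j" "j < n"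
  shows "sing_vals M ! j \<le> sing_vals M ! i"
proof -
  have "sorted (rev (sing_vals M))" unfolding sing_vals_def by simp
  then show ?thesis
    using assms length_sing_vals[OF assms(1)] by (intro sorted_rev_nth_mono) auto
qed

text \<open>The columns of \<open>V\<close> are right singular vectors: those of
  \<open>M * V\<close> are pairwise orthogonal, with the singular values as norms. This serves in
  place of a full singular value decomposition.\<close>

lemma right_singular_basis:
  assumes M: "M \<in> carrier_mat n n"
  obtains V where "unitary_mat n V"
    "mat_adjoint (M * V) * (M * V) = mat_diag n (\<lambda>t. complex_of_real ((sing_vals M ! t)\<^sup>2))"
proof -
  have "mat_adjoint M * M \<in> carrier_mat n n" using M by auto
  from normal_mat_unitarily_diagonalizable[OF this normal_mat_gram mset_sing_vals_squared[OF M]]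
  obtain V where V: "unitary_mat n V" "mat_adjoint V * (mat_adjoint M * M) * V
      = mat_diag n ((!) (map (\<lambda>s. complex_of_real (s\<^sup>2)) (sing_vals M)))" by blast
  have "mat_diag n ((!) (map (\<lambda>s. complex_of_real (s\<^sup>2)) (sing_vals M)))
      = mat_diag n (\<lambda>t. complex_of_real ((sing_vals M ! t)\<^sup>2))"
    using length_sing_vals[OF M] by (intro eq_matI) (auto simp: mat_diag_def)
  then show ?thesis
    using that[OF V(1)] V(2) gram_conjugation[OF M unitary_matD(1)[OF V(1)]] by simp
qed

section \<open>Pythagoras and Bessel for matrices with orthogonal columns\<close>

lemma orthogonal_columns_norm:
  fixes Z :: "complex mat" and y :: "nat \<Rightarrow> complex"
  assumes Z: "Z \<in> carrier_mat n n" and ZZ: "mat_adjoint Z * Z = mat_diag n (\<lambda>t. complex_of_real (\<sigma> t))"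
  shows "(\<Sum>i<n. (cmod (\<Sum>t<n. Z $$ (i, t) * y t))\<^sup>2) = (\<Sum>t<n. \<sigma> t * (cmod (y t))\<^sup>2)"
proof -
  have gram: "(\<Sum>i<n. cnj (Z $$ (i, s)) * Z $$ (i, t)) = (if s = t then complex_of_real (\<sigma> t) else 0)"
    if "s < n" "t < n" for s t
  proof -
    have "(\<Sum>i<n. cnj (Z $$ (i, s)) * Z $$ (i, t)) = (mat_adjoint Z * Z) $$ (s, t)"
      using Z that by (subst index_mult_mat_sum[of _ n n _ n]) auto
    then show ?thesis unfolding ZZ using that by (simp add: mat_diag_def)
  qed
  \<comment> \<open>A squared modulus is a product \<open>cnj z * z\<close>; expanding it and moving
    the sum over \<open>i\<close> innermost exposes the Gram entries.\<close>
  have "complex_of_real (\<Sum>i<n. (cmod (\<Sum>t<n. Z $$ (i, t) * y t))\<^sup>2)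
      = (\<Sum>i<n. cnj (\<Sum>s<n. Z $$ (i, s) * y s) * (\<Sum>t<n. Z $$ (i, t) * y t))"
    unfolding of_real_sum cnj_mult_self ..
  also have "\<dots> = (\<Sum>i<n. \<Sum>s<n. \<Sum>t<n. cnj (y s) * y t * (cnj (Z $$ (i, s)) * Z $$ (i, t)))"
    unfolding cnj_sum sum_product by (intro sum.cong refl) (simp add: algebra_simps)
  also have "\<dots> = (\<Sum>s<n. \<Sum>i<n. \<Sum>t<n. cnj (y s) * y t * (cnj (Z $$ (i, s)) * Z $$ (i, t)))"
    by (rule sum.swap)
  also have "\<dots> = (\<Sum>s<n. \<Sum>t<n. \<Sum>i<n. cnj (y s) * y t * (cnj (Z $$ (i, s)) * Z $$ (i, t)))"
    by (rule sum.cong[OF refl], rule sum.swap)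
  also have "\<dots> = (\<Sum>s<n. \<Sum>t<n. cnj (y s) * y t * (if s = t then complex_of_real (\<sigma> t) else 0))"
    by (intro sum.cong refl) (simp add: sum_distrib_left[symmetric] gram)
  also have "\<dots> = (\<Sum>s<n. cnj (y s) * y s * complex_of_real (\<sigma> s))"
    by (intro sum.cong refl) (simp add: if_distrib[of "(*) _"] cong: if_cong)
  also have "\<dots> = complex_of_real (\<Sum>t<n. \<sigma> t * (cmod (y t))\<^sup>2)"
    unfolding cnj_mult_self by (simp add: mult.commute)
  finally show ?thesis using of_real_eq_iff by blast
qed

text \<open>Bessel's inequality for the \<open>i\<close>-th unit vector. With the coefficients
  \<open>?y\<close>, the \<open>i\<close>-th entry of the combination of columns is
  \<open>?p\<close>, and by Pythagoras its squared norm is also \<open>?p\<close>; hence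
  \<open>?p\<^sup>2 \<le> ?p\<close>.\<close>

lemma orthogonal_columns_bessel:
  fixes Z :: "complex mat"
  assumes Z: "Z \<in> carrier_mat n n" and ZZ: "mat_adjoint Z * Z = mat_diag n (\<lambda>t. complex_of_real (\<sigma> t))"
    and i: "i < n"
  shows "(\<Sum>t<n. (cmod (Z $$ (i, t)))\<^sup>2 / \<sigma> t) \<le> 1" (is "?p \<le> 1")
proof -
  \<comment> \<open>Terms with \<open>\<sigma> t = 0\<close> vanish because \<open>x / 0 = 0\<close>.\<close>
  let ?y = "\<lambda>t. cnj (Z $$ (i, t)) / complex_of_real (\<sigma> t)"
  have "(\<Sum>t<n. Z $$ (i, t) * ?y t) = complex_of_real ?p"
    unfolding of_real_sum by (intro sum.cong refl) (simp add: complex_norm_square del: of_real_power)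
  then have "?p\<^sup>2 = (cmod (\<Sum>t<n. Z $$ (i, t) * ?y t))\<^sup>2"
    by (simp only: norm_of_real power2_abs)
  also have "\<dots> \<le> (\<Sum>l<n. (cmod (\<Sum>t<n. Z $$ (l, t) * ?y t))\<^sup>2)"
    using i by (intro member_le_sum) auto
  also have "\<dots> = (\<Sum>t<n. \<sigma> t * (cmod (?y t))\<^sup>2)"
    by (rule orthogonal_columns_norm[OF Z ZZ])
  also have "\<dots> = ?p"
    by (intro sum.cong refl) (simp add: norm_divide power_divide power2_eq_square)
  finally have "?p\<^sup>2 \<le> ?p" .
  then show ?thesis
    using mult_strict_left_mono[of 1 ?p ?p] unfolding power2_eq_square by linarith
qed

text \<open>The best weights are 1 on the \<open>k\<close> largest values. Relative to the threshold
  \<open>c = \<sigma> (k - 1)\<close>, the differences \<open>\<sigma> t - c\<close> are nonnegative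
  before \<open>k\<close> and nonpositive from \<open>k\<close> on; the part left over is
  \<open>c\<close> times the total weight, at most \<open>c * k\<close>.\<close>

lemma weighted_sum_le_largest:
  fixes \<sigma> w :: "nat \<Rightarrow> real"
  assumes \<sigma>: "\<And>i j. i \<le> j \<Longrightarrow> j < n \<Longrightarrow> \<sigma> j \<le> \<sigma> i" "\<And>i. i < n \<Longrightarrow> 0 \<le> \<sigma> i"
    and w: "\<And>t. t < n \<Longrightarrow> 0 \<le> w t" "\<And>t. t < n \<Longrightarrow> w t \<le> 1" "(\<Sum>t<n. w t) \<le> real k"
    and k: "k \<le> n"
  shows "(\<Sum>t<n. \<sigma> t * w t) \<le> (\<Sum>t<k. \<sigma> t)"
proof (cases "k = 0")
  case True
  have "(\<Sum>t<n. w t) \<ge> 0" by (intro sum_nonneg) (simp add: w(1))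
  then have "(\<Sum>t<n. w t) = 0" using w(3) True by simp
  then have "\<forall>t\<in>{..<n}. w t = 0"
    using sum_nonneg_eq_0_iff[of "{..<n}" w] w(1) by simp
  then show ?thesis using True by simp
next
  case False
  define c where "c = \<sigma> (k - 1)"
  have c: "0 \<le> c" unfolding c_def using False k by (intro \<sigma>(2)) simp
  have "(\<Sum>t<n. \<sigma> t * w t) = (\<Sum>t<n. (\<sigma> t - c) * w t) + c * (\<Sum>t<n. w t)"
    by (simp add: algebra_simps sum.distrib sum_subtractf sum_distrib_left)
  also have "(\<Sum>t<n. (\<sigma> t - c) * w t) \<le> (\<Sum>t<n. if t < k then \<sigma> t - c else 0)"
  proof (rule sum_mono)
    fix t assume t: "t \<in> {..<n}"
    show "(\<sigma> t - c) * w t \<le> (if t < k then \<sigma> t - c else 0)"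
    proof (cases "t < k")
      case True
      then have "\<sigma> t - c \<ge> 0" unfolding c_def using k \<sigma>(1)[of t "k - 1"] by simp
      then show ?thesis using True w t by (simp add: mult_left_le)
    next
      case False
      then have "\<sigma> t - c \<le> 0" unfolding c_def using t \<sigma>(1)[of "k - 1" t] by simp
      then show ?thesis using False w t by (simp add: mult_nonpos_nonneg)
    qed
  qed
  also have "(\<Sum>t<n. if t < k then \<sigma> t - c else 0) = (\<Sum>t<k. \<sigma> t - c)"
    using k by (simp add: sum.If_cases lessThan_def[symmetric] Int_absorb1)
  also have "c * (\<Sum>t<n. w t) \<le> c * real k" using c w(3) by (rule mult_left_mono[rotated])
  finally show ?thesis by (simp add: sum_subtractf)
qed

section \<open>The bound by half of the singular values\<close>

lemma mult_unitary_factorization: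
  fixes M P Q V :: "complex mat"
  assumes "M \<in> carrier_mat n n" "P \<in> carrier_mat n n" "Q \<in> carrier_mat n n" "unitary_mat n V"
  shows "P * M * Q = (P * (M * V)) * (mat_adjoint V * Q)"
proof -
  note v = unitary_matD[OF assms(4)]
  have "(P * (M * V)) * (mat_adjoint V * Q) = P * (M * ((V * mat_adjoint V) * Q))"
    using assms(1-3) v(1) by (auto simp: mult_mat_assoc)
  also have "\<dots> = P * M * Q"
    using assms(1-3) v by (auto simp: mult_mat_assoc)
  finally show ?thesis by simp
qed

text \<open>Take \<open>Z = P * (M * V)\<close> and \<open>Y = mat_adjoint V * Q\<close> with
  \<open>V\<close> a right singular basis: the unitary factor \<open>P\<close> leaves the Gram
  matrix of \<open>M * V\<close> unchanged.\<close>

lemma right_singular_factorization: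
  assumes M: "M \<in> carrier_mat n n" and P: "unitary_mat n P" and Q: "unitary_mat n Q"
  obtains Z Y where "Z \<in> carrier_mat n n" "unitary_mat n Y" "P * M * Q = Z * Y"
    "mat_adjoint Z * Z = mat_diag n (\<lambda>t. complex_of_real ((sing_vals M ! t)\<^sup>2))"
proof -
  note p = unitary_matD[OF P] and q = unitary_matD[OF Q]
  obtain V where V: "unitary_mat n V"
    "mat_adjoint (M * V) * (M * V) = mat_diag n (\<lambda>t. complex_of_real ((sing_vals M ! t)\<^sup>2))"
    using right_singular_basis[OF M] by blast
  note v = unitary_matD[OF V(1)]
  have MV: "M * V \<in> carrier_mat n n" using M v by auto
  have "mat_adjoint (P * (M * V)) * (P * (M * V)) = mat_adjoint (M * V) * mat_adjoint P * (P * (M * V))"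
    using carrier_matD[OF p(1)] carrier_matD[OF MV] by (simp add: mat_adjoint_mult[of P "M * V"])
  also have "\<dots> = mat_adjoint (M * V) * (M * V)"
    using p MV by (intro mult_cancel_middle[of _ n n]) auto
  finally have "mat_adjoint (P * (M * V)) * (P * (M * V))
    = mat_diag n (\<lambda>t. complex_of_real ((sing_vals M ! t)\<^sup>2))" using V(2) by simp
  moreover have "P * M * Q = (P * (M * V)) * (mat_adjoint V * Q)"
    using M p(1) q(1) V(1) by (rule mult_unitary_factorization)
  moreover have "unitary_mat n (mat_adjoint V * Q)"
    by (intro unitary_mat_mult unitary_mat_adjoint V Q)
  moreover have "P * (M * V) \<in> carrier_mat n n" using p MV by auto
  ultimately show ?thesis using that by blast
qed

lemma orthogonal_columns_col_sum:
  fixes Z :: "complex mat"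
  assumes Z: "Z \<in> carrier_mat n n" and ZZ: "mat_adjoint Z * Z = mat_diag n (\<lambda>t. complex_of_real (\<sigma> t))"
    and t: "t < n"
  shows "(\<Sum>i<n. (cmod (Z $$ (i, t)))\<^sup>2) = \<sigma> t"
proof -
  have "complex_of_real (\<Sum>i<n. (cmod (Z $$ (i, t)))\<^sup>2) = of_real (\<sigma> t)"
    using adjoint_mult_self_index[OF Z t] unfolding ZZ using t by (simp add: mat_diag_def)
  then show ?thesis using of_real_eq_iff by blast
qed

lemma sing_vals_squared_weighted_sum_le:
  assumes M: "M \<in> carrier_mat n n"
    and w: "\<And>t. t < n \<Longrightarrow> 0 \<le> w t" "\<And>t. t < n \<Longrightarrow> w t \<le> 1" "(\<Sum>t<n. w t) \<le> real k" and k: "k \<le> n"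
  shows "(\<Sum>t<n. (sing_vals M ! t)\<^sup>2 * w t) \<le> (\<Sum>t<k. (sing_vals M ! t)\<^sup>2)"
  using w k sing_vals_antimono[OF M] sing_vals_nonneg[OF M]
  by (intro weighted_sum_le_largest) (auto intro!: power_mono)

text \<open>By Pythagoras, column \<open>j\<close> of \<open>Z * Y\<close> weights the squared
  singular values by the squared moduli of column \<open>j\<close> of \<open>Y\<close>. Summed over
  \<open>J\<close>, each weight is at most a row norm of \<open>Y\<close>, that is 1, and the total
  weight is \<open>card J\<close>.\<close>

lemma col_sums_le_sing_vals:
  assumes M: "M \<in> carrier_mat n n" and P: "unitary_mat n P" and Q: "unitary_mat n Q"
    and J: "J \<subseteq> {..<n}"
  shows "(\<Sum>j\<in>J. \<Sum>i<n. (cmod ((P * M * Q) $$ (i, j)))\<^sup>2) \<le> (\<Sum>t<card J. (sing_vals M ! t)\<^sup>2)"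
proof -
  obtain Z Y where Z: "Z \<in> carrier_mat n n" and Y: "unitary_mat n Y" and ZY: "P * M * Q = Z * Y"
    and ZZ: "mat_adjoint Z * Z = mat_diag n (\<lambda>t. complex_of_real ((sing_vals M ! t)\<^sup>2))"
    using right_singular_factorization[OF M P Q] by blast
  define w where "w t = (\<Sum>j\<in>J. (cmod (Y $$ (t, j)))\<^sup>2)" for t
  have "(\<Sum>i<n. (cmod ((P * M * Q) $$ (i, j)))\<^sup>2) = (\<Sum>t<n. (sing_vals M ! t)\<^sup>2 * (cmod (Y $$ (t, j)))\<^sup>2)"
    if "j \<in> J" for j
  proof -
    have "(\<Sum>i<n. (cmod ((P * M * Q) $$ (i, j)))\<^sup>2) = (\<Sum>i<n. (cmod (\<Sum>t<n. Z $$ (i, t) * Y $$ (t, j)))\<^sup>2)"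
      unfolding ZY using that J unitary_matD(1)[OF Y]
      by (intro sum.cong refl, subst index_mult_mat_sum[OF Z]) auto
    then show ?thesis using orthogonal_columns_norm[OF Z ZZ] by simp
  qed
  then have "(\<Sum>j\<in>J. \<Sum>i<n. (cmod ((P * M * Q) $$ (i, j)))\<^sup>2)
      = (\<Sum>j\<in>J. \<Sum>t<n. (sing_vals M ! t)\<^sup>2 * (cmod (Y $$ (t, j)))\<^sup>2)" by simp
  also have "\<dots> = (\<Sum>t<n. \<Sum>j\<in>J. (sing_vals M ! t)\<^sup>2 * (cmod (Y $$ (t, j)))\<^sup>2)"
    by (rule sum.swap)
  also have "\<dots> = (\<Sum>t<n. (sing_vals M ! t)\<^sup>2 * w t)"
    unfolding w_def sum_distrib_left ..
  also have "\<dots> \<le> (\<Sum>t<card J. (sing_vals M ! t)\<^sup>2)"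
  proof (rule sing_vals_squared_weighted_sum_le[OF M])
    show "0 \<le> w t" for t unfolding w_def by (intro sum_nonneg) simp
    show "w t \<le> 1" if "t < n" for t
    proof -
      have "w t \<le> (\<Sum>j<n. (cmod (Y $$ (t, j)))\<^sup>2)"
        unfolding w_def using J by (intro sum_mono2) auto
      then show ?thesis using unitary_mat_row_norm[OF Y that] by simp
    qed
    have "(\<Sum>t<n. w t) = (\<Sum>j\<in>J. \<Sum>t<n. (cmod (Y $$ (t, j)))\<^sup>2)"
      unfolding w_def by (rule sum.swap)
    also have "\<dots> = (\<Sum>j\<in>J. 1)"
      using J unitary_mat_col_norm[OF Y] by (intro sum.cong) auto
    finally show "(\<Sum>t<n. w t) \<le> real (card J)" by simp
    show "card J \<le> n" using J card_mono[of "{..<n}" J] by simp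
  qed
  finally show ?thesis .
qed

text \<open>The unitary \<open>Y\<close> preserves row norms, so only \<open>Z\<close> matters. The
  weights come from the normalized columns of \<open>Z\<close>: each is at most 1 because column
  \<open>t\<close> has squared norm \<open>\<sigma> t\<close>, and Bessel bounds the contribution of
  each row in \<open>I\<close> by 1.\<close>

lemma row_sums_le_sing_vals:
  assumes M: "M \<in> carrier_mat n n" and P: "unitary_mat n P" and Q: "unitary_mat n Q"
    and I: "I \<subseteq> {..<n}"
  shows "(\<Sum>i\<in>I. \<Sum>j<n. (cmod ((P * M * Q) $$ (i, j)))\<^sup>2) \<le> (\<Sum>t<card I. (sing_vals M ! t)\<^sup>2)"
proof -
  obtain Z Y where Z: "Z \<in> carrier_mat n n" and Y: "unitary_mat n Y" and ZY: "P * M * Q = Z * Y"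
    and ZZ: "mat_adjoint Z * Z = mat_diag n (\<lambda>t. complex_of_real ((sing_vals M ! t)\<^sup>2))"
    using right_singular_factorization[OF M P Q] by blast
  note y = unitary_matD[OF Y]
  define \<sigma> where "\<sigma> t = (sing_vals M ! t)\<^sup>2" for t
  note ZZ = ZZ[folded \<sigma>_def]
  define w where "w t = (\<Sum>i\<in>I. (cmod (Z $$ (i, t)))\<^sup>2 / \<sigma> t)" for t
  have \<sigma>: "0 \<le> \<sigma> t" for t unfolding \<sigma>_def by simp
  have col: "(\<Sum>i<n. (cmod (Z $$ (i, t)))\<^sup>2) = \<sigma> t" if "t < n" for t
    by (rule orthogonal_columns_col_sum[OF Z ZZ that])
  \<comment> \<open>For \<open>\<sigma> t = 0\<close> the quotient is 0 by convention, but then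
    column \<open>t\<close> vanishes and both sides are 0.\<close>
  have entry: "(cmod (Z $$ (i, t)))\<^sup>2 = \<sigma> t * ((cmod (Z $$ (i, t)))\<^sup>2 / \<sigma> t)" if "i < n" "t < n" for i t
  proof (cases "\<sigma> t = 0")
    case True
    have "(cmod (Z $$ (i, t)))\<^sup>2 \<le> (\<Sum>l<n. (cmod (Z $$ (l, t)))\<^sup>2)"
      using that by (intro member_le_sum) auto
    then show ?thesis using True col[OF that(2)] by simp
  qed simp
  have "(\<Sum>j<n. (cmod ((P * M * Q) $$ (i, j)))\<^sup>2) = (\<Sum>t<n. \<sigma> t * ((cmod (Z $$ (i, t)))\<^sup>2 / \<sigma> t))"
    if "i \<in> I" for i
  proof -
    have i: "i < n" using that I by auto
    have "Z * Y \<in> carrier_mat n n" using Z y by auto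
    \<comment> \<open>The row norm is a diagonal entry of \<open>Z * Y\<close> times its adjoint,
      where \<open>Y\<close> cancels.\<close>
    then have "complex_of_real (\<Sum>j<n. (cmod ((P * M * Q) $$ (i, j)))\<^sup>2)
        = (Z * Y * mat_adjoint (Z * Y)) $$ (i, i)"
      unfolding ZY using i by (subst mult_adjoint_self_index[of _ n n]) auto
    also have "Z * Y * mat_adjoint (Z * Y) = Z * Y * (mat_adjoint Y * mat_adjoint Z)"
      using Z y by (simp add: mat_adjoint_mult)
    also have "\<dots> = Z * mat_adjoint Z"
      using Z y by (intro mult_cancel_middle[of _ n n]) auto
    also have "(Z * mat_adjoint Z) $$ (i, i) = complex_of_real (\<Sum>t<n. (cmod (Z $$ (i, t)))\<^sup>2)"
      by (rule mult_adjoint_self_index[OF Z i])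
    finally have "(\<Sum>j<n. (cmod ((P * M * Q) $$ (i, j)))\<^sup>2) = (\<Sum>t<n. (cmod (Z $$ (i, t)))\<^sup>2)"
      using of_real_eq_iff by blast
    also have "\<dots> = (\<Sum>t<n. \<sigma> t * ((cmod (Z $$ (i, t)))\<^sup>2 / \<sigma> t))"
      by (intro sum.cong refl entry i) simp
    finally show ?thesis .
  qed
  then have "(\<Sum>i\<in>I. \<Sum>j<n. (cmod ((P * M * Q) $$ (i, j)))\<^sup>2)
      = (\<Sum>i\<in>I. \<Sum>t<n. \<sigma> t * ((cmod (Z $$ (i, t)))\<^sup>2 / \<sigma> t))" by simp
  also have "\<dots> = (\<Sum>t<n. \<Sum>i\<in>I. \<sigma> t * ((cmod (Z $$ (i, t)))\<^sup>2 / \<sigma> t))"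
    by (rule sum.swap)
  also have "\<dots> = (\<Sum>t<n. (sing_vals M ! t)\<^sup>2 * w t)"
    unfolding w_def sum_distrib_left \<sigma>_def ..
  also have "\<dots> \<le> (\<Sum>t<card I. (sing_vals M ! t)\<^sup>2)"
  proof (rule sing_vals_squared_weighted_sum_le[OF M])
    show "0 \<le> w t" for t unfolding w_def using \<sigma> by (intro sum_nonneg) simp
    show "w t \<le> 1" if "t < n" for t
    proof -
      have "(\<Sum>i\<in>I. (cmod (Z $$ (i, t)))\<^sup>2) \<le> \<sigma> t"
        unfolding col[OF that, symmetric] using I by (intro sum_mono2) auto
      then show ?thesis unfolding w_def sum_divide_distrib[symmetric] using \<sigma>[of t] by (cases "\<sigma> t = 0") (auto simp: divide_le_eq_1)
    qed
    have "(\<Sum>t<n. w t) = (\<Sum>i\<in>I. \<Sum>t<n. (cmod (Z $$ (i, t)))\<^sup>2 / \<sigma> t)"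
      unfolding w_def by (rule sum.swap)
    also have "\<dots> \<le> (\<Sum>i\<in>I. 1)"
      using I orthogonal_columns_bessel[OF Z ZZ] by (intro sum_mono) auto
    finally show "(\<Sum>t<n. w t) \<le> real (card I)" by simp
    show "card I \<le> n" using I card_mono[of "{..<n}" I] by simp
  qed
  finally show ?thesis .
qed

section \<open>Combinatorics of the matching distance\<close>

lemma matching_dist_le_Max:
  assumes "\<tau> permutes {..<length as}"
  shows "matching_dist as bs \<le> (MAX i\<in>{..<length as}. cmod (as ! i - bs ! \<tau> i))"
  unfolding matching_dist_def using assms by (intro Min_le) (auto simp: finite_permutations)

lemma matching_dist_nonneg:
  assumes "as \<noteq> []"
  shows "0 \<le> matching_dist as bs"
proof -
  let ?P = "{\<tau>. \<tau> permutes {..<length as}}"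
  have "matching_dist as bs \<in> (\<lambda>\<tau>. MAX i\<in>{..<length as}. cmod (as ! i - bs ! \<tau> i)) ` ?P"
    unfolding matching_dist_def by (intro Min_in) (auto simp: finite_permutations intro: permutes_id)
  then obtain \<tau> where "matching_dist as bs = (MAX i\<in>{..<length as}. cmod (as ! i - bs ! \<tau> i))" by blast
  also have "\<dots> \<ge> cmod (as ! 0 - bs ! \<tau> 0)" using assms by (intro Max_ge) auto
  finally show ?thesis using norm_ge_zero order_trans by blast
qed

text \<open>Join \<open>i\<close> to \<open>j\<close> when their distance is strictly below the
  matching distance. A perfect matching of this graph would beat the minimum, so Hall's condition
  fails for some \<open>K\<close>; \<open>J\<close> is the complement of the neighbourhood of
  \<open>K\<close>.\<close>

lemma matching_dist_separated_blocks:
  assumes len: "length as = n" "length bs = n" and n: "0 < n"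
  obtains I J where "I \<subseteq> {..<n}" "J \<subseteq> {..<n}" "card I + card J = n + 1"
    "\<And>i j. i \<in> I \<Longrightarrow> j \<in> J \<Longrightarrow> matching_dist as bs \<le> cmod (as ! i - bs ! j)"
proof -
  define d where "d = matching_dist as bs"
  define E where "E i = {j\<in>{..<n}. cmod (as ! i - bs ! j) < d}" for i
  have no_matching: False if R: "inj_on R {..<n}" "\<And>i. i < n \<Longrightarrow> R i \<in> E i" for R
  proof -
    define \<tau> where "\<tau> i = (if i < n then R i else i)" for i
    have "inj_on \<tau> {..<n}"
      using R(1) inj_on_cong[of "{..<n}" \<tau> R] by (simp add: \<tau>_def)
    moreover have "\<tau> i < n" if "i < n" for i using R(2)[OF that] that by (simp add: \<tau>_def E_def)
    then have "\<tau> ` {..<n} \<subseteq> {..<n}" by blast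
    ultimately have "bij_betw \<tau> {..<n} {..<n}" unfolding bij_betw_def by (simp add: endo_inj_surj)
    then have perm: "\<tau> permutes {..<length as}"
      unfolding len(1) by (rule bij_imp_permutes) (simp add: \<tau>_def)
    have "cmod (as ! i - bs ! \<tau> i) < d" if "i < n" for i
      using R(2)[OF that] that by (simp add: \<tau>_def E_def)
    \<comment> \<open>A maximum of finitely many values below \<open>d\<close> stays strictly below
      \<open>d\<close>.\<close>
    then have "(MAX i\<in>{..<length as}. cmod (as ! i - bs ! \<tau> i)) < d"
      unfolding len(1) using n by (subst Max_less_iff) auto
    then show False using matching_dist_le_Max[OF perm, of bs] unfolding d_def by simp
  qed
  have "\<exists>K. K \<subseteq> {..<n} \<and> \<not> card K \<le> card (\<Union>i\<in>K. E i)"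
  proof (rule ccontr)
    assume "\<nexists>K. K \<subseteq> {..<n} \<and> \<not> card K \<le> card (\<Union>i\<in>K. E i)"
    then have "\<exists>R. inj_on R {..<n} \<and> (\<forall>i\<in>{..<n}. R i \<in> E i)"
      by (intro hall_marriage) (auto simp only: finite_lessThan, simp add: E_def)
    then show False using no_matching by (metis lessThan_iff)
  qed
  then obtain K where K: "K \<subseteq> {..<n}" "card (\<Union>i\<in>K. E i) < card K"
    by (auto simp only: not_le)
  let ?N = "\<Union>i\<in>K. E i"
  have N: "?N \<subseteq> {..<n}" unfolding E_def by auto
  \<comment> \<open>\<open>K\<close> may be larger than its neighbourhood by more than one;
    shrinking it makes the cardinalities add up to exactly \<open>n + 1\<close>.\<close>
  obtain I where I: "I \<subseteq> K" "card I = card ?N + 1"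
    using obtain_subset_with_card_n[of "card ?N + 1" K] K(2) by (metis Suc_eq_plus1 Suc_leI)
  have "card ({..<n} - ?N) = n - card ?N"
    using card_Diff_subset[OF finite_subset[OF N finite_lessThan] N] by simp
  moreover have "card ?N \<le> n" using N card_mono[of "{..<n}" ?N] by simp
  ultimately have "card I + card ({..<n} - ?N) = n + 1" using I(2) by simp
  moreover have "d \<le> cmod (as ! i - bs ! j)" if "i \<in> I" "j \<in> {..<n} - ?N" for i j
  proof -
    have "j \<notin> E i" using that I(1) by blast
    then show ?thesis using that unfolding E_def by auto
  qed
  moreover have "I \<subseteq> {..<n}" using I(1) K(1) by (rule subset_trans)
  ultimately show ?thesis unfolding d_def by (intro that[of I "{..<n} - ?N"]) simp_all
qed

text \<open>The rows in \<open>I\<close> carry total mass \<open>card I\<close>. The part outside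
  \<open>J\<close> is at most the mass of the remaining \<open>n - card J\<close> columns, so the
  block keeps at least \<open>card I + card J - n = 1\<close>.\<close>

lemma unitary_mat_block_sum_ge_one:
  assumes W: "unitary_mat n W" and I: "I \<subseteq> {..<n}" and J: "J \<subseteq> {..<n}" and card: "card I + card J = n + 1"
  shows "1 \<le> (\<Sum>i\<in>I. \<Sum>j\<in>J. (cmod (W $$ (i, j)))\<^sup>2)"
proof -
  let ?f = "\<lambda>i j. (cmod (W $$ (i, j)))\<^sup>2"
  have fin: "finite I" "finite J" using I J by (auto intro: finite_subset)
  have "real (card I) = (\<Sum>i\<in>I. \<Sum>j<n. ?f i j)"
    using unitary_mat_row_norm[OF W] I by (simp add: subset_iff)
  also have "\<dots> = (\<Sum>i\<in>I. (\<Sum>j\<in>J. ?f i j) + (\<Sum>j\<in>{..<n} - J. ?f i j))"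
    using J sum.subset_diff[OF J] by (intro sum.cong refl) (simp add: add.commute)
  also have "\<dots> = (\<Sum>i\<in>I. \<Sum>j\<in>J. ?f i j) + (\<Sum>i\<in>I. \<Sum>j\<in>{..<n} - J. ?f i j)"
    by (rule sum.distrib)
  also have "(\<Sum>i\<in>I. \<Sum>j\<in>{..<n} - J. ?f i j) \<le> (\<Sum>i<n. \<Sum>j\<in>{..<n} - J. ?f i j)"
    using I by (intro sum_mono2) (auto intro: sum_nonneg)
  also have "(\<Sum>i<n. \<Sum>j\<in>{..<n} - J. ?f i j) = (\<Sum>j\<in>{..<n} - J. \<Sum>i<n. ?f i j)"
    by (rule sum.swap)
  also have "\<dots> = real (card ({..<n} - J))"
    using unitary_mat_col_norm[OF W] by simp
  also have "\<dots> = real n - real (card J)"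
    using J fin card_mono[of "{..<n}" J] by (simp add: card_Diff_subset of_nat_diff)
  finally show ?thesis using card by linarith
qed

text \<open>With \<open>W = mat_adjoint P * Q\<close>, the two terms are
  \<open>mat_diag n a * W\<close> and \<open>W * mat_diag n b\<close>, which scale the rows and the
  columns of \<open>W\<close>.\<close>

lemma diagonalized_difference_index:
  fixes A B P Q :: "complex mat"
  assumes A: "A \<in> carrier_mat n n" and B: "B \<in> carrier_mat n n"
    and P: "unitary_mat n P" and Q: "unitary_mat n Q"
    and PA: "mat_adjoint P * A * P = mat_diag n a" and QB: "mat_adjoint Q * B * Q = mat_diag n b"
    and ij: "i < n" "j < n"
  shows "(mat_adjoint P * (A - B) * Q) $$ (i, j) = (a i - b j) * (mat_adjoint P * Q) $$ (i, j)"
proof -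
  note p = unitary_matD[OF P] and q = unitary_matD[OF Q]
  have W: "mat_adjoint P * Q \<in> carrier_mat n n" using p q by auto
  have "mat_diag n a * (mat_adjoint P * Q) = mat_adjoint P * A * P * (mat_adjoint P * Q)"
    unfolding PA ..
  also have "\<dots> = mat_adjoint P * A * Q"
    using p q A by (intro mult_cancel_middle[of _ n n]) auto
  finally have 1: "mat_adjoint P * A * Q = mat_diag n a * (mat_adjoint P * Q)" by simp
  have "(mat_adjoint P * Q) * mat_diag n b = mat_adjoint P * Q * (mat_adjoint Q * (B * Q))"
    unfolding QB[symmetric] using q B by (auto simp: mult_mat_assoc)
  also have "\<dots> = mat_adjoint P * (B * Q)"
    using p q B by (intro mult_cancel_middle[of _ n n]) auto
  also have "\<dots> = mat_adjoint P * B * Q"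
    using p q B by (auto simp: mult_mat_assoc)
  finally have 2: "mat_adjoint P * B * Q = (mat_adjoint P * Q) * mat_diag n b" by simp
  have pa: "mat_adjoint P \<in> carrier_mat n n" using p by simp
  have "mat_adjoint P * (A - B) * Q = mat_adjoint P * A * Q - mat_adjoint P * B * Q"
    using mult_minus_distrib_mat[OF pa A B] minus_mult_distrib_mat[of "mat_adjoint P * A" n n "mat_adjoint P * B" Q n]
      pa A B q(1) by auto
  also have "\<dots> $$ (i, j) = (mat_diag n a * (mat_adjoint P * Q)) $$ (i, j) - ((mat_adjoint P * Q) * mat_diag n b) $$ (i, j)"
    unfolding 1 2 using W ij by (intro index_minus_mat) (auto simp: mat_diag_def)
  finally show ?thesis
    unfolding mat_diag_mult_left[OF W] mat_diag_mult_right[OF W] using ij by (simp add: algebra_simps)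
qed

theorem sing_val_bound_half:
  assumes n: "0 < n"
  shows "sing_val_bound n ((n + 1) div 2)"
  unfolding sing_val_bound_def
proof (intro ballI impI)
  fix A B :: "complex mat"
  assume A: "A \<in> carrier_mat n n" and B: "B \<in> carrier_mat n n" and NA: "normal_mat A" and NB: "normal_mat B"
  let ?m = "(n + 1) div 2"
  let ?M = "A - B"
  define d where "d = spec_dist A B"
  obtain P where P: "unitary_mat n P" "mat_adjoint P * A * P = mat_diag n ((!) (eigvals A))"
    using normal_mat_unitarily_diagonalizable[OF A NA mset_eigvals] by blast
  obtain Q where Q: "unitary_mat n Q" "mat_adjoint Q * B * Q = mat_diag n ((!) (eigvals B))"
    using normal_mat_unitarily_diagonalizable[OF B NB mset_eigvals] by blast
  define W where "W = mat_adjoint P * Q"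
  define N where "N = mat_adjoint P * ?M * Q"
  note P' = unitary_mat_adjoint[OF P(1)]
  have M: "?M \<in> carrier_mat n n" using B by (rule minus_carrier_mat)
  have W: "unitary_mat n W" unfolding W_def by (rule unitary_mat_mult[OF P' Q(1)])
  obtain I J where I: "I \<subseteq> {..<n}" and J: "J \<subseteq> {..<n}" and card: "card I + card J = n + 1"
    and dist: "\<And>i j. i \<in> I \<Longrightarrow> j \<in> J \<Longrightarrow> d \<le> cmod (eigvals A ! i - eigvals B ! j)"
    using matching_dist_separated_blocks[OF length_eigvals[OF A] length_eigvals[OF B] n]
    unfolding d_def spec_dist_def by blast
  have fin: "finite I" "finite J" using I J by (auto intro: finite_subset)
  have "eigvals A \<noteq> []" using length_eigvals[OF A] n by auto
  then have d: "0 \<le> d" unfolding d_def spec_dist_def by (rule matching_dist_nonneg)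
  have "d\<^sup>2 * 1 \<le> d\<^sup>2 * (\<Sum>i\<in>I. \<Sum>j\<in>J. (cmod (W $$ (i, j)))\<^sup>2)"
    by (intro mult_left_mono unitary_mat_block_sum_ge_one[OF W I J card]) simp
  also have "\<dots> = (\<Sum>i\<in>I. \<Sum>j\<in>J. d\<^sup>2 * (cmod (W $$ (i, j)))\<^sup>2)"
    by (simp add: sum_distrib_left)
  also have "\<dots> \<le> (\<Sum>i\<in>I. \<Sum>j\<in>J. (cmod (N $$ (i, j)))\<^sup>2)"
  proof (intro sum_mono)
    fix i j assume ij: "i \<in> I" "j \<in> J"
    then have "N $$ (i, j) = (eigvals A ! i - eigvals B ! j) * W $$ (i, j)"
      unfolding N_def W_def using I J by (intro diagonalized_difference_index[OF A B P(1) Q(1) P(2) Q(2)]) auto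
    then show "d\<^sup>2 * (cmod (W $$ (i, j)))\<^sup>2 \<le> (cmod (N $$ (i, j)))\<^sup>2"
      using dist[OF ij] d by (auto simp: norm_mult power_mult_distrib intro!: mult_right_mono power_mono)
  qed
  also have "\<dots> \<le> (\<Sum>t<?m. (sing_vals ?M ! t)\<^sup>2)"
  \<comment> \<open>Since the cardinalities add up to \<open>n + 1\<close>, one of them is at most
    half of that, rounded down; the block is then enlarged to full columns or full rows.\<close>
  proof (cases "card J \<le> ?m")
    case True
    have "(\<Sum>i\<in>I. \<Sum>j\<in>J. (cmod (N $$ (i, j)))\<^sup>2) \<le> (\<Sum>i<n. \<Sum>j\<in>J. (cmod (N $$ (i, j)))\<^sup>2)"
      using I by (intro sum_mono2) (auto intro: sum_nonneg)
    also have "\<dots> = (\<Sum>j\<in>J. \<Sum>i<n. (cmod (N $$ (i, j)))\<^sup>2)" by (rule sum.swap)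
    also have "\<dots> \<le> (\<Sum>t<card J. (sing_vals ?M ! t)\<^sup>2)"
      unfolding N_def by (rule col_sums_le_sing_vals[OF M P' Q(1) J])
    also have "\<dots> \<le> (\<Sum>t<?m. (sing_vals ?M ! t)\<^sup>2)"
      using True by (intro sum_mono2) auto
    finally show ?thesis .
  next
    case False
    then have I_le: "card I \<le> ?m" using card by linarith
    have "(\<Sum>i\<in>I. \<Sum>j\<in>J. (cmod (N $$ (i, j)))\<^sup>2) \<le> (\<Sum>i\<in>I. \<Sum>j<n. (cmod (N $$ (i, j)))\<^sup>2)"
      using J by (intro sum_mono sum_mono2) auto
    also have "\<dots> \<le> (\<Sum>t<card I. (sing_vals ?M ! t)\<^sup>2)"
      unfolding N_def by (rule row_sums_le_sing_vals[OF M P' Q(1) I])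
    also have "\<dots> \<le> (\<Sum>t<?m. (sing_vals ?M ! t)\<^sup>2)"
      using I_le by (intro sum_mono2) auto
    finally show ?thesis .
  qed
  \<comment> \<open>Shift from list positions, counted from 0, to \<open>sing_val\<close>, counted
    from 1.\<close>
  also have "\<dots> = (\<Sum>k=1..?m. (sing_val k ?M)\<^sup>2)"
    unfolding sing_val_def by (rule sum.reindex_bij_witness[of _ "\<lambda>k. k - 1" Suc]) auto
  finally show "(spec_dist A B)\<^sup>2 \<le> (\<Sum>k=1..?m. (sing_val k ?M)\<^sup>2)" unfolding d_def by simp
qed

section \<open>The largest singular value\<close>

lemma vec_norm2_mult_orthogonal_columns:
  assumes Z: "Z \<in> carrier_mat n n" and ZZ: "mat_adjoint Z * Z = mat_diag n (\<lambda>t. complex_of_real (\<sigma> t))"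
    and y: "y \<in> carrier_vec n"
  shows "vec_norm2 (Z *\<^sub>v y) = sqrt (\<Sum>t<n. \<sigma> t * (cmod (y $ t))\<^sup>2)"
proof -
  have "(Z *\<^sub>v y) $ i = (\<Sum>t<n. Z $$ (i, t) * y $ t)" if "i < n" for i
    using Z y that by (auto simp: scalar_prod_def lessThan_atLeast0 intro!: sum.cong)
  then have "(\<Sum>i<n. (cmod ((Z *\<^sub>v y) $ i))\<^sup>2) = (\<Sum>i<n. (cmod (\<Sum>t<n. Z $$ (i, t) * y $ t))\<^sup>2)"
    by (intro sum.cong) simp_all
  then show ?thesis
    unfolding vec_norm2_def using carrier_matD(1)[OF Z] by (simp only: dim_mult_mat_vec orthogonal_columns_norm[OF Z ZZ])
qed

lemma vec_norm2_unitary: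
  assumes V: "unitary_mat n V" and y: "y \<in> carrier_vec n"
  shows "vec_norm2 (V *\<^sub>v y) = vec_norm2 y"
proof -
  have "mat_adjoint V * V = mat_diag n (\<lambda>t. complex_of_real 1)"
    using unitary_matD[OF V] by simp
  from vec_norm2_mult_orthogonal_columns[OF unitary_matD(1)[OF V] this y]
  have "vec_norm2 (V *\<^sub>v y) = sqrt (\<Sum>t<n. (cmod (y $ t))\<^sup>2)" by (simp only: mult_1)
  then show ?thesis unfolding vec_norm2_def using y by simp
qed

lemma unitary_mat_vec_cancel:
  assumes V: "unitary_mat n V" and x: "x \<in> carrier_vec n"
  shows "V *\<^sub>v (mat_adjoint V *\<^sub>v x) = x"
  using assoc_mult_mat_vec[of V n n "mat_adjoint V" n x] unitary_matD[OF V] x by simp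

text \<open>In the coordinates \<open>y = mat_adjoint V *\<^sub>v x\<close> the squared norm of the
  image of \<open>x\<close> is a sum of \<open>(cmod (y $ t))\<^sup>2\<close> weighted by squared
  singular values. The largest weight bounds the quotient, and the first column of \<open>V\<close>
  attains it.\<close>

lemma sing_val_1_eq_spectral_norm:
  assumes M: "M \<in> carrier_mat n n" and n: "0 < n"
  shows "sing_val 1 M = spectral_norm M"
proof -
  obtain V where V: "unitary_mat n V"
    and gram: "mat_adjoint (M * V) * (M * V) = mat_diag n (\<lambda>t. complex_of_real ((sing_vals M ! t)\<^sup>2))"
    using right_singular_basis[OF M] by blast
  note v = unitary_matD[OF V]
  define s where "s = sing_vals M ! 0"
  have s: "0 \<le> s" unfolding s_def by (rule sing_vals_nonneg[OF M n])
  have MV: "M * V \<in> carrier_mat n n" using M v by auto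
  have norm: "vec_norm2 (M *\<^sub>v (V *\<^sub>v y)) = sqrt (\<Sum>t<n. (sing_vals M ! t)\<^sup>2 * (cmod (y $ t))\<^sup>2)"
    if "y \<in> carrier_vec n" for y
    using vec_norm2_mult_orthogonal_columns[OF MV gram that] assoc_mult_mat_vec[OF M v(1) that] by simp
  let ?q = "\<lambda>x. vec_norm2 (M *\<^sub>v x) / vec_norm2 x"
  have "(SUP x\<in>carrier_vec n. ?q x) = s"
  proof (rule cSup_eq_maximum)
    let ?e = "unit_vec n 0 :: complex vec"
    have e: "?e \<in> carrier_vec n" by simp
    have unit: "(\<Sum>t<n. f t * (cmod (?e $ t))\<^sup>2) = f 0" for f :: "nat \<Rightarrow> real"
    proof -
      have "(\<Sum>t<n. f t * (cmod (?e $ t))\<^sup>2) = (\<Sum>t<n. if t = 0 then f t else 0)"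
        by (intro sum.cong) auto
      then show ?thesis using n by simp
    qed
    have "vec_norm2 ?e = 1"
      unfolding vec_norm2_def using unit[of "\<lambda>_. 1"] by simp
    then have "?q (V *\<^sub>v ?e) = s"
      unfolding norm[OF e] vec_norm2_unitary[OF V e] unit using s by (simp add: s_def)
    moreover have "V *\<^sub>v ?e \<in> carrier_vec n" using v(1) by (intro mult_mat_vec_carrier) auto
    ultimately show "s \<in> ?q ` carrier_vec n" by (intro image_eqI[of _ _ "V *\<^sub>v ?e"]) simp_all
  next
    fix r assume "r \<in> ?q ` carrier_vec n"
    then obtain x where x: "x \<in> carrier_vec n" "r = ?q x" by blast
    define y where "y = mat_adjoint V *\<^sub>v x"
    have y: "y \<in> carrier_vec n" using v(1) x(1) unfolding y_def by (intro mult_mat_vec_carrier) auto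
    have xy: "x = V *\<^sub>v y" unfolding y_def using unitary_mat_vec_cancel[OF V x(1)] by simp
    have "(\<Sum>t<n. (sing_vals M ! t)\<^sup>2 * (cmod (y $ t))\<^sup>2) \<le> (\<Sum>t<n. s\<^sup>2 * (cmod (y $ t))\<^sup>2)"
    proof (intro sum_mono mult_right_mono power_mono)
      fix t assume "t \<in> {..<n}"
      then show "sing_vals M ! t \<le> s" "0 \<le> sing_vals M ! t"
        unfolding s_def using sing_vals_antimono[OF M, of 0 t] sing_vals_nonneg[OF M, of t] by simp_all
    qed simp
    also have "\<dots> = s\<^sup>2 * (\<Sum>t<n. (cmod (y $ t))\<^sup>2)" by (simp add: sum_distrib_left)
    finally have "vec_norm2 (M *\<^sub>v x) \<le> sqrt (s\<^sup>2 * (\<Sum>t<n. (cmod (y $ t))\<^sup>2))"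
      unfolding xy norm[OF y] by (rule real_sqrt_le_mono)
    also have "\<dots> = s * vec_norm2 y"
      unfolding vec_norm2_def using s y by (simp add: real_sqrt_mult)
    also have "vec_norm2 y = vec_norm2 x"
      unfolding xy vec_norm2_unitary[OF V y] ..
    finally have le: "vec_norm2 (M *\<^sub>v x) \<le> s * vec_norm2 x" .
    have "0 \<le> vec_norm2 x" unfolding vec_norm2_def by (simp add: sum_nonneg)
    \<comment> \<open>A vector of norm 0 contributes the quotient 0, which is covered by
      \<open>0 \<le> s\<close>.\<close>
    then show "r \<le> s" unfolding x(2) using le s by (cases "vec_norm2 x = 0") (auto simp: divide_le_eq)
  qed
  then show ?thesis
    using M unfolding spectral_norm_def sing_val_def s_def by simp
qed

lemma spectral_norm_le:
  assumes M: "M \<in> carrier_mat m n" and c: "0 \<le> c"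
    and le: "\<And>x. x \<in> carrier_vec n \<Longrightarrow> vec_norm2 (M *\<^sub>v x) \<le> c * vec_norm2 x"
  shows "spectral_norm M \<le> c"
  unfolding spectral_norm_def
proof (rule cSUP_least)
  show "carrier_vec (dim_col M) \<noteq> ({} :: complex vec set)" using zero_carrier_vec by blast
  fix x :: "complex vec" assume "x \<in> carrier_vec (dim_col M)"
  then have x: "x \<in> carrier_vec n" using M by simp
  have "0 \<le> vec_norm2 x" unfolding vec_norm2_def by (simp add: sum_nonneg)
  then show "vec_norm2 (M *\<^sub>v x) / vec_norm2 x \<le> c"
    using le[OF x] c by (cases "vec_norm2 x = 0") (auto simp: divide_le_eq)
qed

section \<open>A variant of Krause's example\<close>

lemma proots_char_poly_mat_diag:
  fixes a :: "nat \<Rightarrow> complex"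
  shows "proots (char_poly (mat_diag n a)) = mset (map a [0..<n])"
proof -
  have "char_poly (mat_diag n a) = (\<Prod>x\<leftarrow>diag_mat (mat_diag n a). [:- x, 1:])"
    by (intro char_poly_upper_triangular[of _ n]) (auto simp: mat_diag_def)
  also have "diag_mat (mat_diag n a) = map a [0..<n]"
    unfolding diag_mat_def by (auto simp: mat_diag_def)
  finally have 1: "char_poly (mat_diag n a) = (\<Prod>x\<leftarrow>map a [0..<n]. [:- x, 1:])" .
  have "proots (\<Prod>x\<leftarrow>xs. [:- x, 1:]) = mset xs" for xs :: "complex list"
  proof (induction xs)
    case (Cons x xs)
    have "(\<Prod>x\<leftarrow>xs. [:- x, 1:]) \<noteq> 0" by (auto simp: prod_list_zero_iff)
    then show ?case using Cons by (simp add: proots_mult del: mult_pCons_left)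
  qed simp
  then show ?thesis unfolding 1 .
qed

lemma normal_mat_mat_diag: "normal_mat (mat_diag n a)"
  unfolding normal_mat_def by (simp add: mult.commute)

text \<open>The moduli on the left contain the rows of 81 times the 3 by 3 core of the example, and
  \<open>6561 = 81\<^sup>2\<close>. The claim is that the squared norm of the core is at most
  199/10, just below 20.\<close>

lemma krause_form_le:
  fixes x y z :: complex
  shows "(cmod (-102 * x - (224 + 112 * \<i>) * y - (168 + 56 * \<i>) * z))\<^sup>2
       + (cmod (- (224 + 112 * \<i>) * x + (98 + 196 * \<i>) * y - (32 + 96 * \<i>) * z))\<^sup>2
       + (cmod (- (168 + 56 * \<i>) * x - (32 + 96 * \<i>) * y + 98 * \<i> * z))\<^sup>2
     \<le> 199 / 10 * 6561 * ((cmod x)\<^sup>2 + (cmod y)\<^sup>2 + (cmod z)\<^sup>2)" (is "?L \<le> ?R")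
proof -
  \<comment> \<open>\<open>?p\<close>, \<open>?q\<close> and the multiple of \<open>z\<close> come from an \<open>LDL\<^sup>*\<close> factorization of the difference.\<close>
  let ?p = "260799 * x + (103040 + 71680 * \<i>) * y + (-295680 - 71680 * \<i>) * z"
  let ?q = "1319921623 * y + (412894720 + 2700884480 * \<i>) * z"
  \<comment> \<open>Completing squares without fractions: 260799 is the leading entry of the form
    \<open>10 * (?R - ?L)\<close> and \<open>?p\<close> is its first row; what remains depends on
    \<open>y\<close> and \<open>z\<close> only, and 1319921623 is its leading entry divided by
    7.\<close>
  have eq: "1319921623 * (260799 * (10 * (?R - ?L)) - (cmod ?p)\<^sup>2) = 7 * ((cmod ?q)\<^sup>2 + 14107000850976885489 * (cmod z)\<^sup>2)"
    unfolding cmod_power2 by (simp add: power2_eq_square algebra_simps)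
  have "L \<le> R" if "1319921623 * (260799 * (10 * (R - L)) - P) = Q" "0 \<le> P" "0 \<le> Q" for L R P Q :: real
  proof -
    have "0 \<le> 260799 * (10 * (R - L)) - P"
      using that(1,3) by (metis mult_nonneg_nonneg zero_le_mult_iff zero_less_numeral not_le)
    with that(2) show ?thesis by simp
  qed
  from this[OF eq] show ?thesis by simp
qed

text \<open>
  \<open>A = diag a\<close> and \<open>B = U (diag b) U\<close> with \<open>U = 1 - 2 u u\<^sup>T / 81\<close>, where \<open>|u|\<^sup>2 = 81\<close>. The values
  approximate Krause's \<open>a = (1, (4 + 5 \<surd>3 \<i>) / 13, (-1 + 2 \<surd>3 \<i>) / 13)\<close>, scaled by 3, and
  \<open>(\<surd>5, \<surd>2, 1)\<close> for the direction of \<open>u\<close>. Both \<open>a\<^sub>0\<close> and \<open>a\<^sub>1\<close> are at distance at least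
  \<open>\<surd>20\<close> from every \<open>b\<^sub>j\<close> except \<open>b\<^sub>2\<close>, and the padding value \<open>-3\<close> preserves this.
\<close>

definition krause_u :: "nat \<Rightarrow> real" where
  "krause_u i = (if i = 0 then 7 else if i = 1 \<or> i = 2 then 4 else 0)"

definition krause_refl :: "nat \<Rightarrow> complex mat" where
  "krause_refl n = mat n n (\<lambda>(i, j). complex_of_real ((if i = j then 1 else 0) - 2 * krause_u i * krause_u j / 81))"

definition krause_a :: "nat \<Rightarrow> complex" where
  "krause_a i = (if i = 0 then 3 else if i = 1 then 1 + 2 * \<i> else if i = 2 then \<i> else -3)"

definition krause_b :: "nat \<Rightarrow> complex" where
  "krause_b i = (if i < 3 then - krause_a i else -3)"

definition krause_A :: "nat \<Rightarrow> complex mat" where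
  "krause_A n = mat_diag n krause_a"

definition krause_B :: "nat \<Rightarrow> complex mat" where
  "krause_B n = mat_adjoint (krause_refl n) * mat_diag n krause_b * krause_refl n"

lemma sum_lessThan_3_extend:
  fixes f :: "nat \<Rightarrow> 'a::comm_monoid_add"
  assumes "3 \<le> n" "\<And>i. 3 \<le> i \<Longrightarrow> i < n \<Longrightarrow> f i = 0"
  shows "(\<Sum>i<n. f i) = f 0 + f 1 + f 2"
proof -
  have "(\<Sum>i<n. f i) = (\<Sum>i<3. f i)"
    using assms by (intro sum.mono_neutral_right) auto
  also have "\<dots> = f 0 + f 1 + f 2" by (simp add: eval_nat_numeral)
  finally show ?thesis .
qed

lemma krause_refl_adjoint [simp]: "mat_adjoint (krause_refl n) = krause_refl n"
  unfolding krause_refl_def by (intro eq_matI) (auto simp: mult.commute mult.left_commute)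

text \<open>A Householder reflection is symmetric and squares to the identity; 81 is the squared
  norm of \<open>krause_u\<close>.\<close>

lemma krause_refl_unitary:
  assumes n: "3 \<le> n"
  shows "unitary_mat n (krause_refl n)"
proof (rule unitary_matI)
  let ?u = krause_u
  show U: "krause_refl n \<in> carrier_mat n n" unfolding krause_refl_def by simp
  have norm: "(\<Sum>l<n. ?u l * ?u l) = 81"
    by (subst sum_lessThan_3_extend[OF n]) (auto simp: krause_u_def)
  show "mat_adjoint (krause_refl n) * krause_refl n = 1\<^sub>m n"
  proof (rule eq_matI)
    fix i j assume "i < dim_row (1\<^sub>m n :: complex mat)" "j < dim_col (1\<^sub>m n :: complex mat)"
    then have ij: "i < n" "j < n" by auto
    have "(krause_refl n * krause_refl n) $$ (i, j)
        = (\<Sum>l<n. krause_refl n $$ (i, l) * krause_refl n $$ (l, j))"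
      using U ij by (intro index_mult_mat_sum) auto
    also have "\<dots> = of_real (\<Sum>l<n. ((if i = l then 1 else 0) - 2 * ?u i * ?u l / 81) * ((if l = j then 1 else 0) - 2 * ?u l * ?u j / 81))"
      unfolding of_real_sum of_real_mult krause_refl_def using ij by (intro sum.cong refl) auto
    \<comment> \<open>The quadratic term becomes \<open>4 * krause_u i * krause_u j / 81\<close> and
      cancels the two linear terms.\<close>
    also have "(\<Sum>l<n. ((if i = l then 1 else 0) - 2 * ?u i * ?u l / 81) * ((if l = j then 1 else 0) - 2 * ?u l * ?u j / 81))
        = (\<Sum>l<n. (if l = i then (if l = j then 1 else 0) else 0))
          - (\<Sum>l<n. if l = i then 2 * ?u l * ?u j / 81 else 0) - (\<Sum>l<n. if l = j then 2 * ?u i * ?u l / 81 else 0)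
          + 4 * ?u i * ?u j / 6561 * (\<Sum>l<n. ?u l * ?u l)"
      unfolding sum_distrib_left sum_subtractf[symmetric] sum.distrib[symmetric]
      by (intro sum.cong refl) (simp add: field_simps)
    also have "\<dots> = (if i = j then 1 else 0)"
      unfolding norm using ij by simp
    finally show "(mat_adjoint (krause_refl n) * krause_refl n) $$ (i, j) = 1\<^sub>m n $$ (i, j)"
      using ij by simp
  qed (use U in auto)
qed

lemma krause_carrier:
  assumes "3 \<le> n"
  shows "krause_A n \<in> carrier_mat n n" "krause_B n \<in> carrier_mat n n"
  using unitary_matD(1)[OF krause_refl_unitary[OF assms]]
  unfolding krause_A_def krause_B_def by auto

lemma krause_normal:
  assumes "3 \<le> n"
  shows "normal_mat (krause_A n)" "normal_mat (krause_B n)"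
  unfolding krause_A_def krause_B_def
  by (intro normal_mat_mat_diag normal_mat_conjugation[OF krause_refl_unitary[OF assms]] mat_diag_dim)+

section \<open>Spectral distance and norm of the example\<close>

lemma cmod_ge_sqrt20:
  assumes "20 \<le> (Re z)\<^sup>2 + (Im z)\<^sup>2"
  shows "sqrt 20 \<le> cmod z"
  using assms unfolding cmod_def by simp

text \<open>Each of these squared distances is 20 or 36.\<close>

lemma krause_dist:
  assumes "i < 2" "j \<noteq> 2"
  shows "sqrt 20 \<le> cmod (krause_a i - krause_b j)"
proof (rule cmod_ge_sqrt20)
  have "i = 0 \<or> i = 1" "j = 0 \<or> j = 1 \<or> 3 \<le> j" using assms by auto
  then show "20 \<le> (Re (krause_a i - krause_b j))\<^sup>2 + (Im (krause_a i - krause_b j))\<^sup>2"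
    by (elim disjE) (auto simp: krause_a_def krause_b_def power2_eq_square)
qed

text \<open>The indices 0 and 1 compete for the only close partner \<open>krause_b 2\<close>. A
  permutation grants it to at most one of them, so the other is matched at distance at least
  \<open>sqrt 20\<close>.\<close>

lemma krause_spec_dist:
  assumes n: "3 \<le> n"
  shows "sqrt 20 \<le> spec_dist (krause_A n) (krause_B n)"
proof -
  let ?as = "map krause_a [0..<n]" and ?bs = "map krause_b [0..<n]"
  note U = krause_refl_unitary[OF n]
  have "proots (char_poly (krause_B n)) = mset ?bs"
    unfolding krause_B_def char_poly_conjugation[OF U mat_diag_dim] by (rule proots_char_poly_mat_diag)
  then have "spec_dist (krause_A n) (krause_B n) = matching_dist ?as ?bs"
    using krause_carrier[OF n]
    by (intro spec_dist_eqI[of _ n]) (simp_all add: krause_A_def proots_char_poly_mat_diag)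
  moreover have "sqrt 20 \<le> (MAX i\<in>{..<n}. cmod (?as ! i - ?bs ! \<tau> i))" if \<tau>: "\<tau> permutes {..<n}" for \<tau>
  proof -
    have "\<tau> 0 \<noteq> \<tau> 1" using permutes_inj[OF \<tau>] by (simp add: inj_eq)
    then have "\<tau> 0 \<noteq> 2 \<or> \<tau> 1 \<noteq> 2" by auto
    then obtain i where i: "i < 2" "\<tau> i \<noteq> 2" using one_less_numeral_iff pos2 semiring_norm(76) by blast
    have "\<tau> i < n" using permutes_in_image[OF \<tau>, of i] i n by simp
    then have "sqrt 20 \<le> cmod (?as ! i - ?bs ! \<tau> i)" using krause_dist[OF i] i n by simp
    also have "\<dots> \<le> (MAX i\<in>{..<n}. cmod (?as ! i - ?bs ! \<tau> i))"
      using i n by (intro Max_ge) auto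
    finally show ?thesis .
  qed
  then have "sqrt 20 \<le> matching_dist ?as ?bs"
    unfolding matching_dist_def length_map length_upt diff_zero
    by (intro Min.boundedI) (auto simp: finite_permutations intro!: exI[of _ id] permutes_id)
  ultimately show ?thesis by simp
qed

text \<open>Removing the reflection from the right of the difference leaves a matrix supported on a
  3 by 3 block, to which \<open>krause_form_le\<close> applies.\<close>

lemma krause_norm:
  assumes n: "3 \<le> n"
  shows "spectral_norm (krause_A n - krause_B n) \<le> sqrt (199 / 10)"
proof (rule spectral_norm_le)
  let ?U = "krause_refl n" and ?M = "krause_A n - krause_B n"
  note U = krause_refl_unitary[OF n] and u = unitary_matD[OF krause_refl_unitary[OF n], simplified]
  show M: "?M \<in> carrier_mat n n" using krause_carrier(2)[OF n] by (rule minus_carrier_mat)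
  \<comment> \<open>\<open>N\<close> is \<open>A - B\<close> up to a unitary factor, and its entries \<open>(a\<^sub>i - b\<^sub>j) U\<^sub>i\<^sub>j\<close> are explicit.\<close>
  define N where "N = krause_A n * ?U - ?U * mat_diag n krause_b"
  have N: "N \<in> carrier_mat n n" using u(1) unfolding N_def by (intro minus_carrier_mat mult_carrier_mat[OF u(1)] mat_diag_dim)
  have N_index: "N $$ (i, j) = (krause_a i - krause_b j) * ?U $$ (i, j)" if "i < n" "j < n" for i j
    using that u(1) unfolding N_def krause_A_def mat_diag_mult_left[OF u(1)] mat_diag_mult_right[OF u(1)]
    by (simp add: algebra_simps)
  \<comment> \<open>Outside the block the reflection agrees with the identity, and
    \<open>krause_a\<close> and \<open>krause_b\<close> share the padding value.\<close>
  have N_zero: "N $$ (i, j) = 0" if "i < n" "j < n" "3 \<le> i \<or> 3 \<le> j" for i j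
    unfolding N_index[OF that(1,2)] using that
    by (cases "i = j") (auto simp: krause_refl_def krause_u_def krause_a_def krause_b_def)
  have "N * ?U = krause_A n * (?U * ?U) - krause_B n"
    unfolding N_def krause_B_def using u(1) krause_carrier(1)[OF n]
    by (subst minus_mult_distrib_mat[of _ n n _ _ n]) (auto simp: mult_mat_assoc)
  then have NU: "N * ?U = ?M" using u krause_carrier(1)[OF n] by simp
  fix x :: "complex vec" assume x: "x \<in> carrier_vec n"
  define y where "y = ?U *\<^sub>v x"
  have y: "y \<in> carrier_vec n" using u(1) x unfolding y_def by auto
  have Mx: "?M *\<^sub>v x = N *\<^sub>v y"
    unfolding NU[symmetric] y_def using N u(1) x by simp
  have Ny: "(N *\<^sub>v y) $ i = N $$ (i, 0) * y $ 0 + N $$ (i, 1) * y $ 1 + N $$ (i, 2) * y $ 2" if "i < n" for i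
  proof -
    have "(N *\<^sub>v y) $ i = (\<Sum>j<n. N $$ (i, j) * y $ j)"
      using N y that by (auto simp: scalar_prod_def lessThan_atLeast0 intro!: sum.cong)
    also have "\<dots> = N $$ (i, 0) * y $ 0 + N $$ (i, 1) * y $ 1 + N $$ (i, 2) * y $ 2"
      using N_zero that by (intro sum_lessThan_3_extend[OF n]) simp
    finally show ?thesis .
  qed
  have n3: "0 < n" "1 < n" "2 < n" using n by auto
  \<comment> \<open>The factor 81 clears the denominators of the reflection.\<close>
  have entries:
    "81 * N $$ (0, 0) = -102" "81 * N $$ (0, 1) = - (224 + 112 * \<i>)" "81 * N $$ (0, 2) = - (168 + 56 * \<i>)"
    "81 * N $$ (1, 0) = - (224 + 112 * \<i>)" "81 * N $$ (1, 1) = 98 + 196 * \<i>" "81 * N $$ (1, 2) = - (32 + 96 * \<i>)"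
    "81 * N $$ (2, 0) = - (168 + 56 * \<i>)" "81 * N $$ (2, 1) = - (32 + 96 * \<i>)" "81 * N $$ (2, 2) = 98 * \<i>"
    unfolding N_index[OF n3(1) n3(1)] N_index[OF n3(1) n3(2)] N_index[OF n3(1) n3(3)]
      N_index[OF n3(2) n3(1)] N_index[OF n3(2) n3(2)] N_index[OF n3(2) n3(3)]
      N_index[OF n3(3) n3(1)] N_index[OF n3(3) n3(2)] N_index[OF n3(3) n3(3)]
    using n3 by (simp_all add: complex_eq_iff krause_a_def krause_b_def krause_refl_def krause_u_def)
  have Ny81: "81 * (N *\<^sub>v y) $ i
      = 81 * N $$ (i, 0) * y $ 0 + 81 * N $$ (i, 1) * y $ 1 + 81 * N $$ (i, 2) * y $ 2" if "i < n" for i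
    unfolding Ny[OF that] by (simp add: algebra_simps)
  have rows:
    "81 * (N *\<^sub>v y) $ 0 = -102 * y $ 0 - (224 + 112 * \<i>) * y $ 1 - (168 + 56 * \<i>) * y $ 2"
    "81 * (N *\<^sub>v y) $ 1 = - (224 + 112 * \<i>) * y $ 0 + (98 + 196 * \<i>) * y $ 1 - (32 + 96 * \<i>) * y $ 2"
    "81 * (N *\<^sub>v y) $ 2 = - (168 + 56 * \<i>) * y $ 0 - (32 + 96 * \<i>) * y $ 1 + 98 * \<i> * y $ 2"
    unfolding Ny81[OF n3(1)] Ny81[OF n3(2)] Ny81[OF n3(3)] entries by (simp_all add: algebra_simps)
  have "(\<Sum>i<n. (cmod ((N *\<^sub>v y) $ i))\<^sup>2)
      = (cmod ((N *\<^sub>v y) $ 0))\<^sup>2 + (cmod ((N *\<^sub>v y) $ 1))\<^sup>2 + (cmod ((N *\<^sub>v y) $ 2))\<^sup>2"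
    by (intro sum_lessThan_3_extend[OF n]) (simp add: Ny N_zero n3)
  also have "\<dots> = ((cmod (81 * (N *\<^sub>v y) $ 0))\<^sup>2 + (cmod (81 * (N *\<^sub>v y) $ 1))\<^sup>2
      + (cmod (81 * (N *\<^sub>v y) $ 2))\<^sup>2) / 6561"
    by (simp only: norm_mult power_mult_distrib) simp
  also have "\<dots> \<le> 199 / 10 * ((cmod (y $ 0))\<^sup>2 + (cmod (y $ 1))\<^sup>2 + (cmod (y $ 2))\<^sup>2)"
  proof -
    have "L / 6561 \<le> 199 / 10 * R" if "L \<le> 199 / 10 * 6561 * R" for L R :: real
      using that by linarith
    then show ?thesis unfolding rows by this (rule krause_form_le)
  qed
  also have "\<dots> \<le> 199 / 10 * (\<Sum>i<n. (cmod (y $ i))\<^sup>2)"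
  proof -
    have "(\<Sum>i<3. (cmod (y $ i))\<^sup>2) \<le> (\<Sum>i<n. (cmod (y $ i))\<^sup>2)"
      using n by (intro sum_mono2) auto
    then show ?thesis by (simp add: eval_nat_numeral)
  qed
  finally have "(\<Sum>i<n. (cmod ((N *\<^sub>v y) $ i))\<^sup>2) \<le> 199 / 10 * (\<Sum>i<n. (cmod (y $ i))\<^sup>2)" .
  then have "vec_norm2 (N *\<^sub>v y) \<le> sqrt (199 / 10) * vec_norm2 y"
    using N y unfolding vec_norm2_def real_sqrt_mult[symmetric] by simp
  then show "vec_norm2 (?M *\<^sub>v x) \<le> sqrt (199 / 10) * vec_norm2 x"
    unfolding Mx using vec_norm2_unitary[OF U x] unfolding y_def by simp
qed simp

lemma krause_counterexample:
  assumes n: "3 \<le> n"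
  shows "sing_val 1 (krause_A n - krause_B n) < spec_dist (krause_A n) (krause_B n)"
proof -
  have "krause_A n - krause_B n \<in> carrier_mat n n" using krause_carrier(2)[OF n] by (rule minus_carrier_mat)
  then have "sing_val 1 (krause_A n - krause_B n) \<le> sqrt (199 / 10)"
    using sing_val_1_eq_spectral_norm krause_norm[OF n] n by simp
  also have "\<dots> < sqrt 20" by simp
  finally show ?thesis using krause_spec_dist[OF n] by simp
qed

text \<open>For \<open>r = 1\<close> the bound compares squares; as singular values are nonnegative,
  the example contradicts it.\<close>

lemma sing_val_bound_ge_2:
  assumes n: "3 \<le> n" and r: "1 \<le> r" and bound: "sing_val_bound n r"
  shows "2 \<le> r"
proof (rule ccontr)
  assume "\<not> 2 \<le> r"
  then have r1: "r = 1" using r by simp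
  let ?M = "krause_A n - krause_B n"
  have M: "?M \<in> carrier_mat n n" using krause_carrier(2)[OF n] by (rule minus_carrier_mat)
  have "(spec_dist (krause_A n) (krause_B n))\<^sup>2 \<le> (sing_val 1 ?M)\<^sup>2"
    using bound krause_carrier[OF n] krause_normal[OF n] unfolding sing_val_bound_def r1 by simp
  moreover have "0 \<le> sing_val 1 ?M"
    unfolding sing_val_def using sing_vals_nonneg[OF M, of 0] n by simp
  ultimately show False
    using krause_counterexample[OF n] power_strict_mono[of "sing_val 1 ?M" "spec_dist (krause_A n) (krause_B n)" 2] by simp
qed

theorem proposition1p3:
  shows
    "(\<forall>n\<ge>3. \<exists>A\<in>carrier_mat n n. \<exists>B\<in>carrier_mat n n. normal_mat A \<and> normal_mat B \<and>
        spec_dist A B > sing_val 1 (A - B) \<and> sing_val 1 (A - B) = spectral_norm (A - B))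
     \<and> (\<forall>n\<ge>3. \<forall>r. 1 \<le> r \<and> r \<le> n \<and> sing_val_bound n r \<longrightarrow> r \<ge> 2)
     \<and> (\<forall>n\<in>{3, 4}. (n + 1) div 2 = 2 \<and>
        1 \<le> (n + 1) div 2 \<and> (n + 1) div 2 \<le> n \<and> sing_val_bound n ((n + 1) div 2) \<and>
        (\<forall>r. 1 \<le> r \<and> r \<le> n \<and> sing_val_bound n r \<longrightarrow> (n + 1) div 2 \<le> r))"
proof (intro conjI allI ballI impI)
  fix n :: nat assume n: "3 \<le> n"
  have "krause_A n - krause_B n \<in> carrier_mat n n"
    using krause_carrier(2)[OF n] by (rule minus_carrier_mat)
  then have "sing_val 1 (krause_A n - krause_B n) = spectral_norm (krause_A n - krause_B n)"
    using n by (intro sing_val_1_eq_spectral_norm) auto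
  then show "\<exists>A\<in>carrier_mat n n. \<exists>B\<in>carrier_mat n n. normal_mat A \<and> normal_mat B \<and>
        spec_dist A B > sing_val 1 (A - B) \<and> sing_val 1 (A - B) = spectral_norm (A - B)"
    using krause_carrier[OF n] krause_normal[OF n] krause_counterexample[OF n] by blast
next
  fix n r :: nat assume "3 \<le> n" "1 \<le> r \<and> r \<le> n \<and> sing_val_bound n r"
  then show "2 \<le> r" using sing_val_bound_ge_2 by blast
next
  \<comment> \<open>In these two dimensions the general upper bound \<open>(n + 1) div 2\<close>
    meets the lower bound 2.\<close>
  fix n :: nat assume n: "n \<in> {3, 4}"
  then show half: "(n + 1) div 2 = 2" by auto
  show "1 \<le> (n + 1) div 2" "(n + 1) div 2 \<le> n" using n by auto
  show "sing_val_bound n ((n + 1) div 2)" using n by (intro sing_val_bound_half) auto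
  fix r assume "1 \<le> r \<and> r \<le> n \<and> sing_val_bound n r"
  then show "(n + 1) div 2 \<le> r" unfolding half using n by (intro sing_val_bound_ge_2[of n]) auto
qed

end
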